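(* Consider $N$ agents with dynamics $\mathrm{d}x_i=u_i\,\mathrm{d}t+\mathrm{d}v_i$, $x_i(0)=0$, $i\in\{1,\dots,N\}$, an undirected connected communication graph with edge set $\mathcal{E}$ and Laplacian $L$, triggering time sequences $(t_k)_{k\in\mathbb{N}}$ of symmetric stopping times, and the performance measure $$J=\limsup_{M\to\infty}\frac1M\int_0^M\mathbb{E}\big[x(t)^\top L x(t)\big]\,\mathrm{d}t .$$ Let $c_i(\mathcal{I}_{t_k,i},t_k)$ be a common consensus point among all agents, such that $c_i(\mathcal{I}_{t_k,i},t_k)=c_j(\mathcal{I}_{t_k,j},t_k)$ for all $(i,j)\in\mathcal{E}$, $k\in\mathbb{N}$, where $\mathcal{I}_{t,i}$ contains local and broadcast information for agent $i$ until the latest triggering instant with respect to $t$. Then the impulsive control input $u(t)=[u_1(t),\dots,u_N(t)]^\top$ with $$u_i(t)=\sum_{k\in\mathbb{N}}\delta(t-t_k)\big(c_i(\mathcal{I}_{t_k,i},t_k)-x_i(t_k)\big)$$ is an optimal causal control input with respect to $J$.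
   Context: $v_1,\dots,v_N$ are independent standard Brownian motions, $u_i$ is the control input of agent $i$, and $x(t)=[x_1(t),\dots,x_N(t)]^\top$. The graph has node set $\{1,\dots,N\}$ (the agents), no self-loops, and edge set $\mathcal{E}$ of ordered pairs with $(i,j)\in\mathcal{E}\Leftrightarrow(j,i)\in\mathcal{E}$; $L$ is the degree matrix minus the adjacency matrix. $\delta$ is the Dirac delta impulse; in the formula for $u_i$, $x_i(t_k)$ is the state just before the impulse, so the input resets every agent instantaneously to the common consensus point at each $t_k$ and is zero between triggering instants. The sequence $(t_k)_{k\in\mathbb{N}}$ lists in increasing order the times at which transmission events are triggered in the multi-agent system. A control input is causal if each $u_i(t)$ depends only on information transmitted up to time $t$ and on local information up to the latest triggering time instant with respect to $t$. A stopping time is called symmetric if the sign of the governing stochastic process can be changed without influencing the stopping time itself. Optimality refers to minimizing $J$. *)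

theory Defs
  imports "HOL-Probability.Probability"
begin

section \<open>Noise\<close>

definition std_brownian_motion :: "'a measure \<Rightarrow> (real \<Rightarrow> 'a \<Rightarrow> real) \<Rightarrow> bool" where
  "std_brownian_motion M B \<longleftrightarrow>
     (\<forall>s\<ge>0. B s \<in> borel_measurable M) \<and>
     (\<forall>\<omega>\<in>space M. B 0 \<omega> = 0) \<and>
     (\<forall>\<omega>\<in>space M. continuous_on {0..} (\<lambda>s. B s \<omega>)) \<and>
     (\<forall>r s. 0 \<le> r \<longrightarrow> r < s \<longrightarrow>
        distributed M lborel (\<lambda>\<omega>. B s \<omega> - B r \<omega>) (normal_density 0 (sqrt (s - r)))) \<and>
     (\<forall>(p :: nat \<Rightarrow> real) n. 0 \<le> p 0 \<longrightarrow> mono p \<longrightarrow>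
        prob_space.indep_vars M (\<lambda>_. borel) (\<lambda>k \<omega>. B (p (Suc k)) \<omega> - B (p k) \<omega>) {..<n})"

text \<open>The vector \<open>v s \<omega>\<close> collects the values at time \<open>s\<close> of the noises of all agents.
  Independence of the processes is independence of their whole paths.\<close>

definition indep_brownian_motions :: "'a measure \<Rightarrow> (real \<Rightarrow> 'a \<Rightarrow> real ^ 'n) \<Rightarrow> bool" where
  "indep_brownian_motions M v \<longleftrightarrow>
     (\<forall>i. std_brownian_motion M (\<lambda>s \<omega>. v s \<omega> $ i)) \<and>
     prob_space.indep_vars M (\<lambda>_. Pi\<^sub>M {0..} (\<lambda>_. borel)) (\<lambda>i \<omega>. \<lambda>s\<in>{0..}. v s \<omega> $ i) UNIV"

definition noise_filtration :: "'a measure \<Rightarrow> (real \<Rightarrow> 'a \<Rightarrow> real ^ 'n) \<Rightarrow> real \<Rightarrow> 'a measure" where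
  "noise_filtration M v r =
     sigma (space M) {(\<lambda>\<omega>. v s \<omega> $ i) -` A \<inter> space M | s i A. 0 \<le> s \<and> s \<le> r \<and> A \<in> sets borel}"

lemma filtration_noise_filtration: "filtration (space M) (noise_filtration M v)"
proof
  show "space (noise_filtration M v r) = space M" for r
    unfolding noise_filtration_def by (rule space_measure_of) auto
  show "sets (noise_filtration M v r) \<subseteq> sets (noise_filtration M v s)" if "r \<le> s" for r s
    unfolding noise_filtration_def
    by (subst (1 2) sets_measure_of, blast, blast, rule sigma_sets_subseteq) (use that in force)
qed

text \<open>The \<open>\<sigma>\<close>-algebra of the history of all noises up to the random time \<open>S\<close>.\<close>

abbreviation noise_history ::
  "'a measure \<Rightarrow> (real \<Rightarrow> 'a \<Rightarrow> real ^ 'n) \<Rightarrow> ('a \<Rightarrow> real) \<Rightarrow> 'a measure" where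
  "noise_history M v S \<equiv> filtration.pre_sigma (space M) (noise_filtration M v) S"


section \<open>Triggering times\<close>

text \<open>\<open>stage_start t k\<close> is the beginning of stage \<open>k\<close>, the time span from \<open>stage_start t k\<close>
  (included) to \<open>stage_start t (Suc k) = t k\<close> (excluded). Stage \<open>0\<close> precedes the first trigger
  (and is empty where \<open>t 0 = 0\<close>); during stage \<open>Suc k\<close> the latest triggering instant is \<open>t k\<close>.\<close>

fun stage_start :: "(nat \<Rightarrow> 'a \<Rightarrow> real) \<Rightarrow> nat \<Rightarrow> 'a \<Rightarrow> real" where
  "stage_start t 0 = (\<lambda>_. 0)"
| "stage_start t (Suc k) = t k"

definition stage :: "(nat \<Rightarrow> 'a \<Rightarrow> real) \<Rightarrow> nat \<Rightarrow> 'a \<Rightarrow> real set" where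
  "stage t k \<omega> = {stage_start t k \<omega> ..< stage_start t (Suc k) \<omega>}"

definition trigger_times :: "'a measure \<Rightarrow> (nat \<Rightarrow> 'a \<Rightarrow> real) \<Rightarrow> bool" where
  "trigger_times M t \<longleftrightarrow>
     (\<forall>\<omega>\<in>space M. 0 \<le> t 0 \<omega> \<and> strict_mono (\<lambda>k. t k \<omega>) \<and> filterlim (\<lambda>k. t k \<omega>) at_top sequentially)"

abbreviation path_space :: "(real \<Rightarrow> real ^ 'n) measure" where
  "path_space \<equiv> Pi\<^sub>M {0..} (\<lambda>_. borel)"

definition restarted_noise ::
  "(real \<Rightarrow> 'a \<Rightarrow> real ^ 'n) \<Rightarrow> ('a \<Rightarrow> real) \<Rightarrow> 'a \<Rightarrow> real \<Rightarrow> real ^ 'n" where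
  "restarted_noise v S \<omega> = (\<lambda>s\<in>{0..}. v (S \<omega> + s) \<omega> - v (S \<omega>) \<omega>)"

text \<open>The process governing a triggering time \<open>T\<close> is the noise accumulated since the preceding
  instant \<open>S\<close>: the waiting time \<open>T - S\<close> is a functional \<open>\<tau>\<close> of that process (and possibly of the
  history up to \<open>S\<close>). Symmetry means that \<open>\<tau>\<close> is unchanged when the sign of the process is
  flipped. The flip is simultaneous for all agents, which is implied by invariance under
  flips for individual agents. Flipping only the whole path from time \<open>0\<close> would be too weak: the
  next trigger could then still react to the sign of the new noise relative to that of the
  past noise.\<close>

definition symmetric_stopping_time ::
  "'a measure \<Rightarrow> (real \<Rightarrow> 'a \<Rightarrow> real ^ 'n) \<Rightarrow> ('a \<Rightarrow> real) \<Rightarrow> ('a \<Rightarrow> real) \<Rightarrow> bool" where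
  "symmetric_stopping_time M v S T \<longleftrightarrow>
     stopping_time (noise_filtration M v) T \<and>
     (\<exists>\<tau> :: 'a \<Rightarrow> (real \<Rightarrow> real ^ 'n) \<Rightarrow> real.
        (\<lambda>(\<omega>, w). \<tau> \<omega> w) \<in> borel_measurable (noise_history M v S \<Otimes>\<^sub>M path_space) \<and>
        (\<forall>\<omega>\<in>space M. T \<omega> = S \<omega> + \<tau> \<omega> (restarted_noise v S \<omega>)) \<and>
        (\<forall>\<omega>\<in>space M. \<forall>w\<in>space path_space. \<tau> \<omega> (\<lambda>s\<in>{0..}. - w s) = \<tau> \<omega> w))"


section \<open>Control inputs and closed-loop states\<close>

text \<open>A control input is a generalized function
  \<open>u\<^sub>i(s) = density u i s + (\<Sum>m. impulse_weight u i m * \<delta>(s - impulse_time u i m))\<close>, where \<open>\<delta>\<close> is the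
  Dirac impulse. Integrating \<open>dx\<^sub>i = u\<^sub>i ds + dv\<^sub>i\<close> from \<open>x\<^sub>i(0) = 0\<close> gives the right-continuous
  \<open>state\<close>, in which an impulse at time \<open>s\<close> has already acted at \<open>s\<close>, and its left limit
  \<open>state_before\<close>, in which it has not.\<close>

record ('a, 'n) control =
  density :: "'n \<Rightarrow> real \<Rightarrow> 'a \<Rightarrow> real"
  impulse_time :: "'n \<Rightarrow> nat \<Rightarrow> 'a \<Rightarrow> real"
  impulse_weight :: "'n \<Rightarrow> nat \<Rightarrow> 'a \<Rightarrow> real"

definition state ::
  "(real \<Rightarrow> 'a \<Rightarrow> real ^ 'n) \<Rightarrow> ('a, 'n) control \<Rightarrow> real \<Rightarrow> 'a \<Rightarrow> real ^ 'n" where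
  "state v u s \<omega> = (\<chi> i.
     (LINT r:{0..s}|lborel. density u i r \<omega>)
     + (\<Sum>m | impulse_time u i m \<omega> \<le> s. impulse_weight u i m \<omega>) + v s \<omega> $ i)"

definition state_before ::
  "(real \<Rightarrow> 'a \<Rightarrow> real ^ 'n) \<Rightarrow> ('a, 'n) control \<Rightarrow> real \<Rightarrow> 'a \<Rightarrow> real ^ 'n" where
  "state_before v u s \<omega> = (\<chi> i.
     (LINT r:{0..s}|lborel. density u i r \<omega>)
     + (\<Sum>m | impulse_time u i m \<omega> < s. impulse_weight u i m \<omega>) + v s \<omega> $ i)"

definition well_posed :: "'a measure \<Rightarrow> ('a, 'n) control \<Rightarrow> bool" where
  "well_posed M u \<longleftrightarrow> (\<forall>i. AE \<omega> in M. \<forall>s\<ge>0.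
     set_integrable lborel {0..s} (\<lambda>r. density u i r \<omega>) \<and>
     (\<forall>m. 0 \<le> impulse_time u i m \<omega>) \<and> finite {m. impulse_time u i m \<omega> \<le> s})"


section \<open>Information and causality\<close>

text \<open>Local information of agent \<open>i\<close> in stage \<open>k\<close>: the instants \<open>stage_start t l\<close>, \<open>l \<le> k\<close>, and
  the path of \<open>v\<^sub>i\<close> stopped at the latest of them. As agent \<open>i\<close> knows the inputs it
  has applied, observing its own state amounts to observing \<open>v\<^sub>i\<close>.\<close>

definition local_info ::
  "'a measure \<Rightarrow> (real \<Rightarrow> 'a \<Rightarrow> real ^ 'n) \<Rightarrow> (nat \<Rightarrow> 'a \<Rightarrow> real) \<Rightarrow> 'n \<Rightarrow> nat \<Rightarrow> 'a measure" where
  "local_info M v t i k = sigma (space M)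
     ({stage_start t l -` A \<inter> space M | l A. l \<le> k \<and> A \<in> sets borel} \<union>
      {(\<lambda>\<omega>. v (min s (stage_start t k \<omega>)) \<omega> $ i) -` A \<inter> space M | s A. 0 \<le> s \<and> A \<in> sets borel})"

text \<open>\<open>I i k\<close> is the information of agent \<open>i\<close> during stage \<open>k\<close>, so \<open>I i (Suc k)\<close> is its information
  at time \<open>t k\<close>. What the agents broadcast is left open: besides its local information an
  agent may hold anything that the agents together can have observed up to the latest
  triggering instant, and it never forgets.\<close>

definition information_structure ::
  "'a measure \<Rightarrow> (real \<Rightarrow> 'a \<Rightarrow> real ^ 'n) \<Rightarrow> (nat \<Rightarrow> 'a \<Rightarrow> real) \<Rightarrow> ('n \<Rightarrow> nat \<Rightarrow> 'a measure) \<Rightarrow> bool" where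
  "information_structure M v t I \<longleftrightarrow> (\<forall>i k.
     subalgebra (I i k) (local_info M v t i k) \<and>
     subalgebra (noise_history M v (stage_start t k)) (I i k) \<and>
     subalgebra (I i (Suc k)) (I i k))"

text \<open>In every stage, the density and the times and weights of the impulses that occur are
  determined by the information available in that stage.\<close>

definition causal_input ::
  "'a measure \<Rightarrow> (nat \<Rightarrow> 'a \<Rightarrow> real) \<Rightarrow> ('n \<Rightarrow> nat \<Rightarrow> 'a measure) \<Rightarrow> ('a, 'n) control \<Rightarrow> bool" where
  "causal_input M t I u \<longleftrightarrow> well_posed M u \<and> (\<forall>i k.
     (\<exists>g. (\<lambda>(s, \<omega>). g s \<omega>) \<in> borel_measurable (borel \<Otimes>\<^sub>M I i k) \<and>
        (AE \<omega> in M. \<forall>s\<in>stage t k \<omega>. density u i s \<omega> = g s \<omega>)) \<and>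
     (\<forall>m. \<exists>\<theta>\<in>borel_measurable (I i k). \<exists>h\<in>borel_measurable (I i k).
        AE \<omega> in M. \<forall>s\<in>stage t k \<omega>. (impulse_time u i m \<omega> = s \<longleftrightarrow> \<theta> \<omega> = s) \<and>
          (impulse_time u i m \<omega> = s \<longrightarrow> impulse_weight u i m \<omega> = h \<omega>)))"


section \<open>Communication graph and performance measure\<close>

definition adjacency_matrix :: "('n \<times> 'n) set \<Rightarrow> real ^ 'n ^ 'n" where
  "adjacency_matrix E = (\<chi> i j. if (i, j) \<in> E then 1 else 0)"

definition degree_matrix :: "('n \<times> 'n) set \<Rightarrow> real ^ 'n ^ 'n" where
  "degree_matrix E = (\<chi> i j. if i = j then real (card {l. (i, l) \<in> E}) else 0)"

definition laplacian :: "('n \<times> 'n) set \<Rightarrow> real ^ 'n ^ 'n" where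
  "laplacian E = degree_matrix E - adjacency_matrix E"

text \<open>For an undirected graph the quadratic form is nonnegative, so the expectation, the time
  integral and the limit superior are taken in \<open>[0, \<infinity>]\<close>.\<close>

definition performance ::
  "'a measure \<Rightarrow> (real \<Rightarrow> 'a \<Rightarrow> real ^ 'n::finite) \<Rightarrow> ('n \<times> 'n) set \<Rightarrow> ('a, 'n) control \<Rightarrow> ennreal" where
  "performance M v E u = Limsup at_top (\<lambda>T::real.
     ennreal (1 / T) *
     (\<integral>\<^sup>+ s\<in>{0..T}. (\<integral>\<^sup>+ \<omega>. ennreal (state v u s \<omega> \<bullet> (laplacian E *v state v u s \<omega>)) \<partial>M) \<partial>lborel))"

text \<open>Competitors may come with a different information structure, since the content of the
  messages may depend on the inputs; \<open>I' = I\<close> is the case of fixed information.\<close>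

definition optimal_causal_input ::
  "'a measure \<Rightarrow> (real \<Rightarrow> 'a \<Rightarrow> real ^ 'n::finite) \<Rightarrow> (nat \<Rightarrow> 'a \<Rightarrow> real) \<Rightarrow> ('n \<times> 'n) set \<Rightarrow>
     ('n \<Rightarrow> nat \<Rightarrow> 'a measure) \<Rightarrow> ('a, 'n) control \<Rightarrow> bool" where
  "optimal_causal_input M v t E I u \<longleftrightarrow> causal_input M t I u \<and>
     (\<forall>I' u'. information_structure M v t I' \<and> causal_input M t I' u' \<longrightarrow>
        performance M v E u \<le> performance M v E u')"


section \<open>The impulsive control input\<close>

text \<open>\<open>c i k\<close> is the consensus point used by agent \<open>i\<close> at \<open>t k\<close>, a function of its information at
  that time.\<close>

definition consensus_points ::
  "'a measure \<Rightarrow> ('n \<times> 'n) set \<Rightarrow> ('n \<Rightarrow> nat \<Rightarrow> 'a measure) \<Rightarrow> ('n \<Rightarrow> nat \<Rightarrow> 'a \<Rightarrow> real) \<Rightarrow> bool" where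
  "consensus_points M E I c \<longleftrightarrow>
     (\<forall>i k. c i k \<in> borel_measurable (I i (Suc k))) \<and>
     (\<forall>(i, j)\<in>E. \<forall>k. \<forall>\<omega>\<in>space M. c i k \<omega> = c j k \<omega>)"

text \<open>\<open>u\<^sub>i(s) = (\<Sum>k. \<delta>(s - t k) * (c i k - x\<^sub>i(t k)))\<close> with \<open>x\<^sub>i(t k)\<close> taken just before the impulse.
  This is a feedback law, hence an equation for \<open>u\<close>.\<close>

definition consensus_reset_input ::
  "'a measure \<Rightarrow> (real \<Rightarrow> 'a \<Rightarrow> real ^ 'n) \<Rightarrow> (nat \<Rightarrow> 'a \<Rightarrow> real) \<Rightarrow> ('n \<Rightarrow> nat \<Rightarrow> 'a \<Rightarrow> real) \<Rightarrow>
     ('a, 'n) control \<Rightarrow> bool" where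
  "consensus_reset_input M v t c u \<longleftrightarrow> (\<forall>i. \<forall>\<omega>\<in>space M.
     (\<forall>s. density u i s \<omega> = 0) \<and>
     (\<forall>k. impulse_time u i k \<omega> = t k \<omega> \<and>
          impulse_weight u i k \<omega> = c i k \<omega> - state_before v u (t k \<omega>) \<omega> $ i))"

end

theory Submission
  imports Defs
begin

text \<open>During a stage that starts at \<open>S\<close> the reset input leaves, up to a common offset that the
  Laplacian ignores, the state \<open>w = v s - v S\<close>, whereas a causal competitor has the state \<open>w + y\<close>
  with \<open>y\<close> determined by the history up to \<open>S\<close>. By the strong Markov property \<open>w\<close> may be replaced
  by \<open>- w\<close> without changing its joint law with that history, and symmetry of the next trigger
  keeps the event that the stage still lasts at time \<open>s\<close>. Hence the mixed term of the quadratic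
  form averages to zero and the competitor pays at least the cost of \<open>w\<close>, for every time and
  every stage.\<close>

section \<open>Laws on path space and random times\<close>

text \<open>Only the sign symmetry of the restarted noise given the history is established, not its
  independence from the history. At a fixed time the symmetry comes from flipping the later Brownian
  increments; at a stopping time it comes from rounding the time up to a grid and refining the grid.
  The product \<sigma>-algebra on path space does not see continuity of paths, so limits of laws are
  controlled by products of continuous functions of finitely many coordinates. The history is kept
  as a \<sigma>-algebra on outcomes, which covers messages of any content. The mixed term is never
  integrated, since costs may be infinite and it need not be integrable: adding the costs of
  \<open>w + y\<close> and \<open>- w + y\<close> removes it pointwise, and all integrals stay in
  [0, \<infinity>].\<close>

lemma borel_measurable_vecI:
  fixes f :: "'a \<Rightarrow> real ^ 'n::finite"
  assumes "\<And>i. (\<lambda>x. f x $ i) \<in> borel_measurable N"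
  shows "f \<in> borel_measurable N"
  using assms by (subst borel_measurable_euclidean_space) (auto simp: Basis_vec_def inner_axis)

lemma closed_indicator_approximation:
  fixes C :: "'b::metric_space set"
  assumes "closed C"
  obtains \<phi> :: "nat \<Rightarrow> 'b \<Rightarrow> real" where
    "\<And>m. continuous_on UNIV (\<phi> m)" "\<And>m x. 0 \<le> \<phi> m x" "\<And>m x. \<phi> m x \<le> 1"
    "\<And>x. (\<lambda>m. \<phi> m x) \<longlonglongrightarrow> indicator C x"
\<comment> \<open>The empty set is treated apart: \<open>infdist\<close> to it is 0 by convention,
  so the tent functions below would be constantly 1.\<close>
proof (cases "C = {}")
  case True
  then show thesis by (intro that[of "\<lambda>_ _. 0"]) auto
next
  case False
  define \<phi> where "\<phi> m x = max 0 (1 - real m * infdist x C)" for m x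
  have "(\<lambda>m. \<phi> m x) \<longlonglongrightarrow> indicator C x" for x
  proof (cases "x \<in> C")
    case True
    then show ?thesis by (simp add: \<phi>_def)
  next
    case x: False
    then have pos: "infdist x C > 0"
      using assms False in_closed_iff_infdist_zero[of C x] infdist_nonneg[of x C] by auto
    obtain m0 :: nat where m0: "real m0 * infdist x C > 1"
      using reals_Archimedean3[OF pos] by blast
    have "\<phi> m x = 0" if "m \<ge> m0" for m
    proof -
      have "real m0 * infdist x C \<le> real m * infdist x C"
        using that pos by (intro mult_right_mono) auto
      then show ?thesis using m0 by (simp add: \<phi>_def)
    qed
    then have "eventually (\<lambda>m. \<phi> m x = 0) sequentially"
      using eventually_sequentially by blast
    then show ?thesis using x by (simp add: tendsto_eventually)
  qed
  moreover have "continuous_on UNIV (\<phi> m)" for m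
    unfolding \<phi>_def by (intro continuous_intros)
  moreover have "\<phi> m x \<le> 1" "0 \<le> \<phi> m x" for m x
    by (auto simp: \<phi>_def infdist_nonneg)
  ultimately show thesis by (intro that[of \<phi>]) auto
qed

text \<open>Cylinders with finitely many closed constraints are stable under intersection and
  generate the product \<sigma>-algebra, and each of their indicators is a bounded pointwise limit
  of products of continuous functions. Such test functions are compatible with pointwise limits of
  paths, which is what the passage from grid times to a stopping time requires.\<close>

lemma PiM_borel_eqI_continuous:
  fixes P Q :: "('i \<Rightarrow> 'b::metric_space) measure"
  assumes sets_P: "sets P = sets (Pi\<^sub>M I (\<lambda>_. borel))" and sets_Q: "sets Q = sets (Pi\<^sub>M I (\<lambda>_. borel))"
    and "finite_measure P" and "finite_measure Q"
    and eq: "\<And>J \<phi>. finite J \<Longrightarrow> J \<subseteq> I \<Longrightarrow> (\<And>j. continuous_on UNIV (\<phi> j)) \<Longrightarrow>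
      (\<And>j x. 0 \<le> \<phi> j x) \<Longrightarrow> (\<And>j x. \<phi> j x \<le> (1::real)) \<Longrightarrow>
      (\<integral>w. (\<Prod>j\<in>J. \<phi> j (w j)) \<partial>P) = (\<integral>w. (\<Prod>j\<in>J. \<phi> j (w j)) \<partial>Q)"
  shows "P = Q"
proof -
  interpret P: finite_measure P by fact
  interpret Q: finite_measure Q by fact
  define \<Omega> :: "('i \<Rightarrow> 'b) set" where "\<Omega> = Pi\<^sub>E I (\<lambda>_. UNIV)"
  define cyl where "cyl J A = {w \<in> \<Omega>. \<forall>j\<in>J. w j \<in> A j}" for J :: "'i set" and A :: "'i \<Rightarrow> 'b set"
  define G where "G = {cyl J A | J A. finite J \<and> J \<subseteq> I \<and> (\<forall>j. closed (A j))}"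
  have sp: "space (Pi\<^sub>M I (\<lambda>_. borel :: 'b measure)) = \<Omega>"
    by (simp add: space_PiM \<Omega>_def)
  have space: "space P = \<Omega>" "space Q = \<Omega>"
    using sets_eq_imp_space_eq[OF sets_P] sets_eq_imp_space_eq[OF sets_Q] sp by auto
  have cyl_sets: "cyl J A \<in> sets (Pi\<^sub>M I (\<lambda>_. borel))"
    if [simp]: "finite J" and J: "J \<subseteq> I" and A: "\<forall>j. closed (A j)" for J A
  proof -
    have "Measurable.pred (Pi\<^sub>M I (\<lambda>_. borel)) (\<lambda>w. w j \<in> A j)" if "j \<in> J" for j
    proof -
      have [measurable]: "j \<in> I" using that J by auto
      have [measurable]: "A j \<in> sets borel" using A by auto
      show ?thesis by measurable
    qed
    then have "Measurable.pred (Pi\<^sub>M I (\<lambda>_. borel)) (\<lambda>w. \<forall>j\<in>J. w j \<in> A j)"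
      by (intro pred_intros_finite) auto
    then show ?thesis unfolding cyl_def pred_def sp .
  qed
  have G_sub: "G \<subseteq> Pow \<Omega>" by (auto simp: G_def cyl_def)
  have sets_G: "sets (Pi\<^sub>M I (\<lambda>_. borel)) = sigma_sets \<Omega> G"
  proof
    have *: "sets (sigma \<Omega> G) = sigma_sets \<Omega> G" "space (sigma \<Omega> G) = \<Omega>"
      using G_sub by auto
    have coord: "(\<lambda>w. w i) \<in> borel_measurable (sigma \<Omega> G)" if "i \<in> I" for i
      unfolding borel_eq_closed
    proof (intro measurable_measure_of)
      fix C :: "'b set" assume "C \<in> Collect closed"
      then have "cyl {i} (\<lambda>_. C) \<in> G" using that unfolding G_def by auto
      moreover have "(\<lambda>w. w i) -` C \<inter> space (sigma \<Omega> G) = cyl {i} (\<lambda>_. C)"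
        unfolding * cyl_def by auto
      ultimately show "(\<lambda>w. w i) -` C \<inter> space (sigma \<Omega> G) \<in> sets (sigma \<Omega> G)"
        unfolding * by auto
    qed auto
    have "sets (Pi\<^sub>M I (\<lambda>_. borel)) \<subseteq> sets (sigma \<Omega> G)"
    proof (rule sets_PiM_in_sets)
      show "space (sigma \<Omega> G) = (\<Pi>\<^sub>E i\<in>I. space (borel :: 'b measure))"
        unfolding * by (simp add: \<Omega>_def)
      fix i and A :: "'b set" assume "i \<in> I" "A \<in> sets borel"
      then show "{x \<in> space (sigma \<Omega> G). x i \<in> A} \<in> sets (sigma \<Omega> G)"
        using measurable_sets[OF coord[of i], of A] by (simp add: vimage_def Int_def conj_commute)
    qed
    then show "sets (Pi\<^sub>M I (\<lambda>_. borel)) \<subseteq> sigma_sets \<Omega> G"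
      unfolding * .
    show "sigma_sets \<Omega> G \<subseteq> sets (Pi\<^sub>M I (\<lambda>_. borel))"
      unfolding sp[symmetric] by (rule sets.sigma_sets_subset) (use cyl_sets in \<open>auto simp: G_def\<close>)
  qed
  show ?thesis
  proof (rule measure_eqI_generator_eq[of G \<Omega> P Q "\<lambda>_. \<Omega>"])
    show "Int_stable G"
    proof (rule Int_stableI)
      fix X Y assume "X \<in> G" "Y \<in> G"
      then obtain J A K B where X: "X = cyl J A" "finite J" "J \<subseteq> I" "\<forall>j. closed (A j)"
        and Y: "Y = cyl K B" "finite K" "K \<subseteq> I" "\<forall>j. closed (B j)"
        unfolding G_def by blast
      \<comment> \<open>Missing constraints are filled with the closed set \<open>UNIV\<close>, so
        that both cylinders constrain the same coordinates.\<close>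
      let ?C = "\<lambda>j. (if j \<in> J then A j else UNIV) \<inter> (if j \<in> K then B j else UNIV)"
      have "X \<inter> Y = cyl (J \<union> K) ?C"
        unfolding X Y cyl_def by (auto split: if_splits)
      moreover have "\<forall>j. closed (?C j)" using X Y by (auto intro: closed_Int)
      ultimately show "X \<inter> Y \<in> G"
        unfolding G_def using X Y by (intro CollectI exI[of _ "J \<union> K"] exI[of _ ?C] conjI) auto
    qed
    show "emeasure P X = emeasure Q X" if "X \<in> G" for X
    proof -
      obtain J A where X: "X = cyl J A" and J[simp]: "finite J" "J \<subseteq> I" and A: "\<And>j. closed (A j)"
        using \<open>X \<in> G\<close> unfolding G_def by blast
      have "\<exists>\<phi> :: nat \<Rightarrow> 'b \<Rightarrow> real. (\<forall>m. continuous_on UNIV (\<phi> m)) \<and> (\<forall>m x. 0 \<le> \<phi> m x) \<and>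
        (\<forall>m x. \<phi> m x \<le> 1) \<and> (\<forall>x. (\<lambda>m. \<phi> m x) \<longlonglongrightarrow> indicator (A j) x)" for j
        by (rule closed_indicator_approximation[OF A[of j]]) blast
      then obtain \<phi> :: "'i \<Rightarrow> nat \<Rightarrow> 'b \<Rightarrow> real" where
        \<phi>: "\<And>j m. continuous_on UNIV (\<phi> j m)" "\<And>j m x. 0 \<le> \<phi> j m x"
        "\<And>j m x. \<phi> j m x \<le> 1" "\<And>j x. (\<lambda>m. \<phi> j m x) \<longlonglongrightarrow> indicator (A j) x"
        by metis
      define f where "f m w = (\<Prod>j\<in>J. \<phi> j m (w j))" for m w
      have lim: "(\<lambda>m. \<integral>w. f m w \<partial>R) \<longlonglongrightarrow> measure R X"
        if R: "finite_measure R" "sets R = sets (Pi\<^sub>M I (\<lambda>_. borel))" for R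
      proof -
        interpret R: finite_measure R by fact
        have spR: "space R = \<Omega>" using sets_eq_imp_space_eq[OF R(2)] sp by simp
        have XR: "X \<in> sets R" using X cyl_sets[OF J] A R(2) by auto
        have ind: "(\<Prod>j\<in>J. indicator (A j) (w j)) = (indicator X w :: real)" if w: "w \<in> space R" for w
        proof (cases "w \<in> X")
          case True
          then show ?thesis by (auto simp: X cyl_def intro!: prod.neutral)
        next
          case False
          then obtain j where "j \<in> J" "w j \<notin> A j" using w unfolding spR X cyl_def by blast
          then show ?thesis using False by (auto intro!: prod_zero bexI[of _ j])
        qed
        have "(\<lambda>m. \<integral>w. f m w \<partial>R) \<longlonglongrightarrow> (\<integral>w. indicator X w \<partial>R)"
        proof (rule integral_dominated_convergence[where w = "\<lambda>_. 1"])
          show "indicator X \<in> borel_measurable R" using XR by simp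
          show "f m \<in> borel_measurable R" for m
          proof -
            have "(\<lambda>w. \<phi> j m (w j)) \<in> borel_measurable (Pi\<^sub>M I (\<lambda>_. borel))" if "j \<in> J" for j
            proof -
              have [measurable]: "j \<in> I" using that by (rule subsetD[OF J(2)])
              have [measurable]: "\<phi> j m \<in> borel_measurable borel"
                using \<phi>(1) by (rule borel_measurable_continuous_onI)
              show ?thesis by measurable
            qed
            then have "f m \<in> borel_measurable (Pi\<^sub>M I (\<lambda>_. borel))"
              unfolding f_def by (rule borel_measurable_prod)
            then show ?thesis using measurable_cong_sets[OF R(2) refl] by auto
          qed
          show "integrable R (\<lambda>_. 1 :: real)" by simp
          show "AE w in R. (\<lambda>m. f m w) \<longlonglongrightarrow> indicator X w"
          proof (rule AE_I2)
            fix w assume "w \<in> space R"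
            have "(\<lambda>m. f m w) \<longlonglongrightarrow> (\<Prod>j\<in>J. indicator (A j) (w j))"
              unfolding f_def by (intro tendsto_prod \<phi>)
            then show "(\<lambda>m. f m w) \<longlonglongrightarrow> indicator X w" using ind[OF \<open>w \<in> space R\<close>] by simp
          qed
          have "norm (f m w) \<le> 1" for m w
            unfolding f_def using \<phi> by (auto simp: abs_prod intro!: prod_le_1)
          then show "AE w in R. norm (f m w) \<le> 1" for m by simp
        qed
        then show ?thesis using XR by (simp add: sets.sets_into_space[OF XR] Int_absorb2)
      qed
      have "(\<integral>w. f m w \<partial>P) = (\<integral>w. f m w \<partial>Q)" for m
        unfolding f_def by (rule eq) (auto simp: \<phi> J(2)[THEN subsetD])
      then have "(\<lambda>m. \<integral>w. f m w \<partial>P) = (\<lambda>m. \<integral>w. f m w \<partial>Q)" by simp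
      then have "measure P X = measure Q X"
        using lim[OF \<open>finite_measure P\<close> sets_P] lim[OF \<open>finite_measure Q\<close> sets_Q]
        using LIMSEQ_unique by metis
      then show ?thesis
        by (simp add: P.emeasure_eq_measure Q.emeasure_eq_measure)
    qed
    have "\<Omega> = cyl {} (\<lambda>_. UNIV)" by (simp add: cyl_def)
    then have "\<Omega> \<in> G" unfolding G_def by blast
    then show "range (\<lambda>_. \<Omega>) \<subseteq> G" by auto
  qed (use G_sub sets_G sets_P sets_Q in auto)
qed

text \<open>The rounding goes upwards because, at a nonnegative grid point \<open>q\<close>, the
  condition \<open>grid n r \<le> q\<close> is then the same as \<open>r \<le> q\<close>, so
  rounding a stopping time does not look ahead. Through \<open>nat\<close>, negative arguments
  become 0 and grid times are always admissible times.\<close>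

definition grid :: "nat \<Rightarrow> real \<Rightarrow> real" where
  "grid n r = real (nat \<lceil>real (Suc n) * r\<rceil>) / real (Suc n)"

lemma grid_nonneg: "0 \<le> grid n r"
  by (simp add: grid_def)

lemma grid_tendsto:
  assumes "0 \<le> r"
  shows "(\<lambda>n. grid n r) \<longlonglongrightarrow> r"
proof (rule tendsto_sandwich[where f = "\<lambda>_. r" and h = "\<lambda>n. r + 1 / real (Suc n)"])
  have c: "real (nat \<lceil>real (Suc n) * r\<rceil>) = real_of_int \<lceil>real (Suc n) * r\<rceil>" for n
  proof -
    have "0 \<le> real (Suc n) * r" using assms by simp
    then have "0 \<le> \<lceil>real (Suc n) * r\<rceil>" by linarith
    then show ?thesis by simp
  qed
  show "\<forall>\<^sub>F n in sequentially. r \<le> grid n r"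
  proof (rule always_eventually, rule allI)
    fix n
    have "real (Suc n) * r \<le> real (nat \<lceil>real (Suc n) * r\<rceil>)"
      unfolding c by linarith
    then show "r \<le> grid n r" unfolding grid_def by (simp add: pos_le_divide_eq mult.commute)
  qed
  show "\<forall>\<^sub>F n in sequentially. grid n r \<le> r + 1 / real (Suc n)"
  proof (rule always_eventually, rule allI)
    fix n
    have "real (nat \<lceil>real (Suc n) * r\<rceil>) \<le> real (Suc n) * r + 1"
      unfolding c by linarith
    also have "\<dots> = (r + 1 / real (Suc n)) * real (Suc n)"
      by (simp add: field_simps)
    finally show "grid n r \<le> r + 1 / real (Suc n)"
      unfolding grid_def by (subst pos_divide_le_eq) auto
  qed
  show "(\<lambda>n. r + 1 / real (Suc n)) \<longlonglongrightarrow> r"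
    using tendsto_add[OF tendsto_const LIMSEQ_inverse_real_of_nat, of r]
    by (simp add: inverse_eq_divide)
qed simp

lemma continuous_grid_tendsto:
  fixes f :: "real \<Rightarrow> 'b::topological_space"
  assumes "continuous_on {0..} f" "0 \<le> r"
  shows "(\<lambda>n. f (grid n r)) \<longlonglongrightarrow> f r"
  using assms by (intro continuous_on_tendsto_compose[OF assms(1) grid_tendsto])
    (auto simp: grid_nonneg)

text \<open>A grid time takes countably many values, so measurability at fixed times is
  enough.\<close>

lemma measurable_at_grid_time:
  assumes X: "\<And>s. 0 \<le> s \<Longrightarrow> X s \<in> measurable N L"
    and [measurable]: "R \<in> borel_measurable N"
  shows "(\<lambda>\<omega>. X (grid n (R \<omega>)) \<omega>) \<in> measurable N L"
  unfolding grid_def by (rule measurable_compose_countable) (auto intro: X)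

text \<open>Path continuity replaces joint measurability of \<open>X\<close>: the value at
  \<open>R\<close> is the limit of the values at grid times.\<close>

lemma borel_measurable_at_random_time:
  fixes X :: "real \<Rightarrow> 'a \<Rightarrow> 'b::metric_space"
  assumes X: "\<And>s. 0 \<le> s \<Longrightarrow> X s \<in> borel_measurable N"
    and R: "R \<in> borel_measurable N" "\<And>\<omega>. \<omega> \<in> space N \<Longrightarrow> 0 \<le> R \<omega>"
    and cont: "\<And>\<omega>. \<omega> \<in> space N \<Longrightarrow> continuous_on {0..} (\<lambda>s. X s \<omega>)"
  shows "(\<lambda>\<omega>. X (R \<omega>) \<omega>) \<in> borel_measurable N"
  by (rule borel_measurable_LIMSEQ_metric[OF measurable_at_grid_time[OF X R(1)]])
    (auto intro: continuous_grid_tendsto cont R)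

section \<open>Reflection of Brownian motion\<close>

lemma normal_distr_symmetric:
  assumes "prob_space M" "distributed M lborel X (normal_density 0 \<sigma>)" "0 < \<sigma>"
  shows "distr M borel (\<lambda>\<omega>. - X \<omega>) = distr M borel X"
proof -
  interpret prob_space M by fact
  have "distributed M lborel (\<lambda>\<omega>. 0 + (-1) * X \<omega>) (normal_density (0 + (-1) * 0) (\<bar>-1\<bar> * \<sigma>))"
    using assms(2,3) by (intro normal_density_affine) auto
  then have "distr M lborel (\<lambda>\<omega>. - X \<omega>) = distr M lborel X"
    using assms(2) by (simp add: distributed_distr_eq_density)
  moreover have "distr M lborel Y = distr M borel Y" for Y :: "'a \<Rightarrow> real"
    by (rule distr_cong) auto
  ultimately show ?thesis by metis
qed

text \<open>Independence makes the joint law the product of the marginal laws, and each marginal is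
  unchanged by its sign. The index set \<open>{..<Suc n}\<close> is nonempty, as the criterion for
  independence through product laws demands.\<close>

lemma distr_sign_flip:
  fixes D :: "nat \<Rightarrow> 'a \<Rightarrow> real"
  assumes "prob_space M" "prob_space.indep_vars M (\<lambda>_. borel) D {..<Suc n}"
    and sym: "\<And>k. distr M borel (\<lambda>\<omega>. - D k \<omega>) = distr M borel (D k)"
    and \<epsilon>: "\<And>k. \<epsilon> k = 1 \<or> \<epsilon> k = (-1 :: real)"
  shows "distr M (Pi\<^sub>M {..<Suc n} (\<lambda>_. borel)) (\<lambda>\<omega>. \<lambda>k\<in>{..<Suc n}. \<epsilon> k * D k \<omega>) =
    distr M (Pi\<^sub>M {..<Suc n} (\<lambda>_. borel)) (\<lambda>\<omega>. \<lambda>k\<in>{..<Suc n}. D k \<omega>)"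
proof -
  interpret prob_space M by fact
  have rv: "random_variable borel (D k)" if "k \<in> {..<Suc n}" for k
    using assms(2) that unfolding indep_vars_def by auto
  have ind: "indep_vars (\<lambda>_. borel) (\<lambda>k \<omega>. \<epsilon> k * D k \<omega>) {..<Suc n}"
    by (rule indep_vars_compose2[OF assms(2)]) auto
  have same: "distr M borel (\<lambda>\<omega>. \<epsilon> k * D k \<omega>) = distr M borel (D k)" for k
    using \<epsilon>[of k] sym[of k] by auto
  have "distr M (Pi\<^sub>M {..<Suc n} (\<lambda>_. borel)) (\<lambda>\<omega>. \<lambda>k\<in>{..<Suc n}. \<epsilon> k * D k \<omega>) =
      (\<Pi>\<^sub>M k\<in>{..<Suc n}. distr M borel (\<lambda>\<omega>. \<epsilon> k * D k \<omega>))"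
    using ind by (subst indep_vars_iff_distr_eq_PiM'[symmetric]) (use rv in auto)
  also have "\<dots> = (\<Pi>\<^sub>M k\<in>{..<Suc n}. distr M borel (D k))"
    unfolding same ..
  also have "\<dots> = distr M (Pi\<^sub>M {..<Suc n} (\<lambda>_. borel)) (\<lambda>\<omega>. \<lambda>k\<in>{..<Suc n}. D k \<omega>)"
    using assms(2) by (subst indep_vars_iff_distr_eq_PiM'[THEN iffD1]) (use rv in auto)
  finally show ?thesis .
qed

text \<open>\<open>std_brownian_motion\<close> speaks of increments along monotone sequences,
  whereas a cylinder event involves an arbitrary finite set of times. Starting at 0 makes every
  value of the path a sum of increments.\<close>

lemma finite_mono_enumeration:
  fixes K :: "real set"
  assumes "finite K" "K \<subseteq> {0..}"
  obtains p :: "nat \<Rightarrow> real" and n where "mono p" "p 0 = 0" "K \<subseteq> p ` {..n}"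
proof -
  define xs where "xs = sorted_list_of_set (insert 0 K)"
  define n where "n = length xs - 1"
  have set: "set xs = insert 0 K" and sorted: "sorted xs"
    using assms(1) unfolding xs_def by (simp_all only: set_sorted_list_of_set sorted_sorted_list_of_set finite_insert)
  then have len: "0 < length xs" by (cases xs) auto
  \<comment> \<open>Constant from index \<open>n\<close> on, which keeps the sequence monotone on
    all natural numbers and makes later increments zero.\<close>
  define p where "p k = xs ! min k n" for k
  show thesis
  proof
    show "mono p"
      unfolding p_def n_def
      using sorted len by (auto simp: less_eq_Suc_le intro!: monoI sorted_nth_mono)
    obtain k where k: "k < length xs" "xs ! k = 0"
      using set by (metis in_set_conv_nth insertI1)
    have "xs ! 0 \<in> set xs" using len by auto
    then have "0 \<le> xs ! 0" using set assms by auto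
    moreover have "xs ! 0 \<le> xs ! k" using sorted k by (intro sorted_nth_mono) auto
    ultimately show "p 0 = 0" using k by (simp add: p_def)
    show "K \<subseteq> p ` {..n}"
    proof
      fix x assume "x \<in> K"
      then obtain k where k: "k < length xs" "xs ! k = x"
        using set by (metis in_set_conv_nth insertI2)
      then have "p k = x" "k \<le> n" by (auto simp: p_def n_def)
      then show "x \<in> p ` {..n}" by auto
    qed
  qed
qed

text \<open>Finite-dimensional events depend on sums of increments. Flipping the path after
  \<open>q\<close> multiplies exactly the later increments by -1, and their joint law does not
  notice signs.\<close>

lemma brownian_flip_law:
  assumes "prob_space M" "std_brownian_motion M B" "0 \<le> q"
  shows "distr M (Pi\<^sub>M {0..} (\<lambda>_. borel)) (\<lambda>\<omega>. \<lambda>s\<in>{0..}. if s \<le> q then B s \<omega> else 2 * B q \<omega> - B s \<omega>) =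
    distr M (Pi\<^sub>M {0..} (\<lambda>_. borel)) (\<lambda>\<omega>. \<lambda>s\<in>{0..}. B s \<omega>)" (is "distr M ?P ?F = distr M ?P ?B")
proof -
  interpret prob_space M by fact
  have rv: "\<And>s. 0 \<le> s \<Longrightarrow> B s \<in> borel_measurable M" and B0: "\<And>\<omega>. \<omega> \<in> space M \<Longrightarrow> B 0 \<omega> = 0"
    and normal: "\<And>r s. 0 \<le> r \<Longrightarrow> r < s \<Longrightarrow>
      distributed M lborel (\<lambda>\<omega>. B s \<omega> - B r \<omega>) (normal_density 0 (sqrt (s - r)))"
    and indep: "\<And>p n. 0 \<le> p 0 \<Longrightarrow> mono p \<Longrightarrow>
      indep_vars (\<lambda>_. borel) (\<lambda>k \<omega>. B (p (Suc k)) \<omega> - B (p k) \<omega>) {..<n::nat}"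
    using assms(2) unfolding std_brownian_motion_def by blast+
  have mB: "?B \<in> measurable M ?P"
    by (intro measurable_restrict rv) auto
  have mF: "?F \<in> measurable M ?P"
    by (intro measurable_restrict measurable_If borel_measurable_diff borel_measurable_times rv)
      (use assms(3) rv in auto)
  show ?thesis
  proof (rule measure_eqI_PiM_infinite)
    fix A :: "real \<Rightarrow> real set" and J :: "real set"
    assume J: "finite J" "J \<subseteq> {0..}" and A: "\<And>i. i \<in> J \<Longrightarrow> A i \<in> sets borel"
    \<comment> \<open>With \<open>q\<close> among the partition points, no increment straddles
      \<open>q\<close> and each has a definite sign.\<close>
    have "finite (insert q J)" "insert q J \<subseteq> {0..}" using J assms(3) by auto
    then obtain p :: "nat \<Rightarrow> real" and n :: nat where p: "mono p" "p 0 = 0" "insert q J \<subseteq> p ` {..n}"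
      by (rule finite_mono_enumeration)
    define D where "D k \<omega> = B (p (Suc k)) \<omega> - B (p k) \<omega>" for k \<omega>
    define \<epsilon> :: "nat \<Rightarrow> real" where "\<epsilon> k = (if p (Suc k) \<le> q then 1 else -1)" for k
    have p_nonneg: "0 \<le> p k" for k using p(1,2) by (metis monoD zero_le)
    have "\<forall>j\<in>J. \<exists>k. p k = j \<and> k \<le> n" using p(3) by fastforce
    then obtain \<kappa> where \<kappa>: "\<And>j. j \<in> J \<Longrightarrow> p (\<kappa> j) = j \<and> \<kappa> j \<le> n"
      by metis
    obtain m where m: "q = p m" using p(3) by auto
    \<comment> \<open>The normal law is given for intervals of positive length only; a repeated
      partition point gives the increment 0.\<close>
    have symD: "distr M borel (\<lambda>\<omega>. - D k \<omega>) = distr M borel (D k)" for k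
    proof (cases "p k < p (Suc k)")
      case True
      then show ?thesis unfolding D_def
        using normal_distr_symmetric[OF assms(1) normal[OF p_nonneg True]] by simp
    next
      case False
      then have "p (Suc k) = p k" using p(1) by (metis le_SucI monoD order_le_less order_refl)
      then have "(\<lambda>\<omega>. - D k \<omega>) = D k" by (simp add: D_def fun_eq_iff)
      then show ?thesis by simp
    qed
    have law: "distr M (Pi\<^sub>M {..<Suc n} (\<lambda>_. borel)) (\<lambda>\<omega>. \<lambda>k\<in>{..<Suc n}. \<epsilon> k * D k \<omega>) =
        distr M (Pi\<^sub>M {..<Suc n} (\<lambda>_. borel)) (\<lambda>\<omega>. \<lambda>k\<in>{..<Suc n}. D k \<omega>)"
    proof (rule distr_sign_flip[OF assms(1) _ symD])
      show "indep_vars (\<lambda>_. borel) D {..<Suc n}"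
        unfolding D_def by (rule indep) (use p in auto)
    qed (auto simp: \<epsilon>_def)
    have B_sum: "B (p k) \<omega> = (\<Sum>l<k. D l \<omega>)" if "\<omega> \<in> space M" for k \<omega>
      unfolding D_def using sum_lessThan_telescope[of "\<lambda>k. B (p k) \<omega>" k] B0[OF that] p(2) by simp
    \<comment> \<open>Past \<open>q\<close> the signed sum is
      \<open>B q \<omega> - (B (p k) \<omega> - B q \<omega>)\<close>, which is the flipped
      value.\<close>
    have F_sum: "(if p k \<le> q then B (p k) \<omega> else 2 * B q \<omega> - B (p k) \<omega>) = (\<Sum>l<k. \<epsilon> l * D l \<omega>)"
      if \<omega>: "\<omega> \<in> space M" for k \<omega>
    proof (induction k)
      case 0
      then show ?case using p(2) B0[OF \<omega>] assms(3) by simp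
    next
      case (Suc k)
      have le: "p k \<le> p (Suc k)" using p(1) by (auto intro: monoD)
      have ge: "q \<le> p k" if "\<not> p (Suc k) \<le> q"
      proof -
        have "m \<le> k" using that m p(1) by (metis monoD not_less_eq_eq)
        then show ?thesis using m p(1) by (auto intro: monoD)
      qed
      show ?case
      proof (cases "p (Suc k) \<le> q")
        case True
        then show ?thesis using Suc le by (simp add: \<epsilon>_def D_def)
      next
        case False
        have "(\<Sum>l<k. \<epsilon> l * D l \<omega>) = 2 * B q \<omega> - B (p k) \<omega>"
          using ge[OF False] by (auto simp flip: Suc.IH)
        then show ?thesis using False by (simp add: \<epsilon>_def D_def)
      qed
    qed
    \<comment> \<open>The cylinder event, rewritten as a condition on the vector of
      increments.\<close>
    define G where "G = {w \<in> space (Pi\<^sub>M {..<Suc n} (\<lambda>_. borel :: real measure)). \<forall>j\<in>J. (\<Sum>l<\<kappa> j. w l) \<in> A j}"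
    have G: "G \<in> sets (Pi\<^sub>M {..<Suc n} (\<lambda>_. borel))"
    proof -
      have "Measurable.pred (Pi\<^sub>M {..<Suc n} (\<lambda>_. borel)) (\<lambda>w. (\<Sum>l<\<kappa> j. w l) \<in> A j)" if "j \<in> J" for j
      proof -
        have [measurable]: "A j \<in> sets borel" by (rule A) fact
        have "(\<lambda>w. \<Sum>l<\<kappa> j. w l) \<in> borel_measurable (Pi\<^sub>M {..<Suc n} (\<lambda>_. borel :: real measure))"
          using \<kappa>[OF that] by (intro borel_measurable_sum measurable_component_singleton) auto
        then show ?thesis by measurable
      qed
      then have "Measurable.pred (Pi\<^sub>M {..<Suc n} (\<lambda>_. borel)) (\<lambda>w. \<forall>j\<in>J. (\<Sum>l<\<kappa> j. w l) \<in> A j)"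
        using J by (intro pred_intros_finite) auto
      then show ?thesis unfolding G_def pred_def .
    qed
    have mD: "D k \<in> borel_measurable M" for k
      unfolding D_def by (intro borel_measurable_diff rv p_nonneg)
    let ?emb = "prod_emb {0..} (\<lambda>_. borel) J (Pi\<^sub>E J A)"
    have emb: "?emb \<in> sets ?P"
      using J A by (intro sets_PiM_I) auto
    have emb_iff: "(\<lambda>s\<in>{0..}. f s) \<in> ?emb \<longleftrightarrow> (\<forall>j\<in>J. f j \<in> A j)" for f :: "real \<Rightarrow> real"
      using J by (auto simp: prod_emb_def PiE_iff)
    have cut: "(\<Sum>l<\<kappa> j. (\<lambda>k\<in>{..<Suc n}. f k) l) = (\<Sum>l<\<kappa> j. f l)" if "j \<in> J" for j and f :: "nat \<Rightarrow> real"
      using \<kappa>[OF that] by (intro sum.cong) auto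
    have "emeasure (distr M ?P ?F) ?emb = emeasure M {\<omega> \<in> space M. \<forall>j\<in>J. (\<Sum>l<\<kappa> j. \<epsilon> l * D l \<omega>) \<in> A j}"
    proof (subst emeasure_distr[OF mF emb], rule arg_cong[where f = "emeasure M"])
      show "?F -` ?emb \<inter> space M = {\<omega> \<in> space M. \<forall>j\<in>J. (\<Sum>l<\<kappa> j. \<epsilon> l * D l \<omega>) \<in> A j}"
        unfolding vimage_def emb_iff using F_sum \<kappa> by (auto simp flip: F_sum)
    qed
    also have "\<dots> = emeasure (distr M (Pi\<^sub>M {..<Suc n} (\<lambda>_. borel)) (\<lambda>\<omega>. \<lambda>k\<in>{..<Suc n}. \<epsilon> k * D k \<omega>)) G"
      by (subst emeasure_distr[OF _ G])
        (use cut mD in \<open>auto simp: G_def space_PiM intro!: arg_cong[where f = "emeasure M"] measurable_restrict\<close>)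
    also have "\<dots> = emeasure (distr M (Pi\<^sub>M {..<Suc n} (\<lambda>_. borel)) (\<lambda>\<omega>. \<lambda>k\<in>{..<Suc n}. D k \<omega>)) G"
      unfolding law ..
    also have "\<dots> = emeasure M {\<omega> \<in> space M. \<forall>j\<in>J. (\<Sum>l<\<kappa> j. D l \<omega>) \<in> A j}"
      by (subst emeasure_distr[OF _ G])
        (use cut mD in \<open>auto simp: G_def space_PiM intro!: arg_cong[where f = "emeasure M"] measurable_restrict\<close>)
    also have "\<dots> = emeasure (distr M ?P ?B) ?emb"
    proof (subst emeasure_distr[OF mB emb], rule arg_cong[where f = "emeasure M"])
      show "{\<omega> \<in> space M. \<forall>j\<in>J. (\<Sum>l<\<kappa> j. D l \<omega>) \<in> A j} = ?B -` ?emb \<inter> space M"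
        unfolding vimage_def emb_iff using \<kappa> by (auto simp flip: B_sum)
    qed
    finally show "emeasure (distr M ?P ?F) ?emb = emeasure (distr M ?P ?B) ?emb" .
  next
    show "finite_measure (distr M ?P ?F)"
      using prob_space_distr[OF mF] by (simp add: prob_space.finite_measure)
  qed simp_all
qed

definition reflect_path :: "(real \<Rightarrow> real ^ 'n) \<Rightarrow> real \<Rightarrow> real ^ 'n" where
  "reflect_path w = (\<lambda>s\<in>{0..}. - w s)"

lemma measurable_reflect_path [measurable]: "reflect_path \<in> measurable path_space path_space"
  unfolding reflect_path_def[abs_def] by (intro measurable_restrict) measurable

section \<open>Reflection of the vector noise at a fixed time\<close>

locale brownian_noise = prob_space M for M :: "'a measure" +
  fixes v :: "real \<Rightarrow> 'a \<Rightarrow> real ^ 'n::finite"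
  assumes brownian: "indep_brownian_motions M v"
begin

lemma brownian_component: "std_brownian_motion M (\<lambda>s \<omega>. v s \<omega> $ i)"
  and indep_components: "indep_vars (\<lambda>_. Pi\<^sub>M {0..} (\<lambda>_. borel)) (\<lambda>i \<omega>. \<lambda>s\<in>{0..}. v s \<omega> $ i) UNIV"
  using brownian unfolding indep_brownian_motions_def by blast+

lemma noise_measurable_component: "0 \<le> s \<Longrightarrow> (\<lambda>\<omega>. v s \<omega> $ i) \<in> borel_measurable M"
  using brownian_component[of i] unfolding std_brownian_motion_def by blast

lemma noise_measurable: "0 \<le> s \<Longrightarrow> v s \<in> borel_measurable M"
  by (intro borel_measurable_vecI noise_measurable_component)

lemma noise_0: "\<omega> \<in> space M \<Longrightarrow> v 0 \<omega> = 0"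
  using brownian_component unfolding std_brownian_motion_def by (simp add: vec_eq_iff)

lemma noise_continuous: "\<omega> \<in> space M \<Longrightarrow> continuous_on {0..} (\<lambda>s. v s \<omega>)"
proof -
  assume "\<omega> \<in> space M"
  then have "continuous_on {0..} (\<lambda>s. \<chi> i. v s \<omega> $ i)"
    using brownian_component unfolding std_brownian_motion_def
    by (intro continuous_on_vec_lambda) blast
  then show ?thesis by simp
qed

sublocale filtration "space M" "noise_filtration M v"
  by (rule filtration_noise_filtration)

lemma sets_noise_filtration:
  "sets (noise_filtration M v r) = sigma_sets (space M)
    {(\<lambda>\<omega>. v s \<omega> $ i) -` A \<inter> space M | s i A. 0 \<le> s \<and> s \<le> r \<and> A \<in> sets borel}"
  unfolding noise_filtration_def by (rule sets_measure_of) blast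

lemma sets_noise_filtration_subset: "sets (noise_filtration M v r) \<subseteq> sets M"
  unfolding sets_noise_filtration
  by (rule sets.sigma_sets_subset) (use noise_measurable_component in \<open>auto intro: measurable_sets\<close>)

text \<open>The path transformation of the reflection principle, at a fixed time:
  \<open>2 *\<^sub>R v q \<omega> - v s \<omega>\<close> is \<open>v q \<omega>\<close> minus the
  increment since \<open>q\<close>.\<close>

definition reflected_noise :: "real \<Rightarrow> 'a \<Rightarrow> real \<Rightarrow> real ^ 'n" where
  "reflected_noise q \<omega> = (\<lambda>s\<in>{0..}. if s \<le> q then v s \<omega> else 2 *\<^sub>R v q \<omega> - v s \<omega>)"

lemma measurable_noise_path: "(\<lambda>\<omega>. \<lambda>s\<in>{0..}. v s \<omega>) \<in> measurable M path_space"
  by (intro measurable_restrict noise_measurable) auto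

lemma measurable_reflected_noise: "0 \<le> q \<Longrightarrow> reflected_noise q \<in> measurable M path_space"
  unfolding reflected_noise_def[abs_def]
  by (intro measurable_restrict measurable_If borel_measurable_diff borel_measurable_scaleR
      noise_measurable) (auto intro: noise_measurable)

text \<open>The flip acts on each component separately, so it preserves independence of the
  component paths. Each component keeps its law by \<open>brownian_flip_law\<close>, hence the
  product laws coincide.\<close>

lemma distr_reflected_noise:
  assumes "0 \<le> q"
  shows "distr M path_space (reflected_noise q) = distr M path_space (\<lambda>\<omega>. \<lambda>s\<in>{0..}. v s \<omega>)"
proof -
  let ?P = "Pi\<^sub>M {0..} (\<lambda>_. borel) :: (real \<Rightarrow> real) measure"
  let ?X = "\<lambda>i \<omega>. \<lambda>s\<in>{0..}. v s \<omega> $ i"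
  define fl :: "(real \<Rightarrow> real) \<Rightarrow> real \<Rightarrow> real" where
    "fl w = (\<lambda>s\<in>{0..}. if s \<le> q then w s else 2 * w q - w s)" for w
  \<comment> \<open>Turns a family of scalar paths into one path of vectors, which transports the
    equality of product laws to \<open>path_space\<close>.\<close>
  define vec :: "('n \<Rightarrow> real \<Rightarrow> real) \<Rightarrow> real \<Rightarrow> real ^ 'n" where
    "vec W = (\<lambda>s\<in>{0..}. \<chi> i. W i s)" for W
  have [measurable]: "q \<in> {0..}" using assms by simp
  have fl: "fl \<in> measurable ?P ?P"
    unfolding fl_def[abs_def] by (intro measurable_restrict) measurable
  have fl_X: "fl (?X i \<omega>) = (\<lambda>s\<in>{0..}. if s \<le> q then v s \<omega> $ i else 2 * v q \<omega> $ i - v s \<omega> $ i)" for i \<omega>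
    using assms by (auto simp: fl_def fun_eq_iff)
  have X: "random_variable ?P (?X i)" for i
    by (intro measurable_restrict noise_measurable_component) auto
  have flX: "random_variable ?P (\<lambda>\<omega>. fl (?X i \<omega>))" for i
    using measurable_comp[OF X fl] by (simp add: comp_def)
  have vec: "vec \<in> measurable (Pi\<^sub>M UNIV (\<lambda>_. ?P)) path_space"
    unfolding vec_def[abs_def]
  proof (intro measurable_restrict borel_measurable_vecI)
    fix s :: real and i :: 'n assume s: "s \<in> {0..}"
    have "(\<lambda>W. (W i) s) \<in> borel_measurable (Pi\<^sub>M UNIV (\<lambda>_. ?P))"
      by (rule measurable_compose[where f = "\<lambda>W. W i" and g = "\<lambda>w. w s" and N = ?P])
        (use s in auto)
    then show "(\<lambda>W. (\<chi> i. W i s) $ i) \<in> borel_measurable (Pi\<^sub>M UNIV (\<lambda>_. ?P))" by simp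
  qed
  have "indep_vars (\<lambda>_. ?P) (\<lambda>i \<omega>. fl (?X i \<omega>)) UNIV"
    by (rule indep_vars_compose2[OF indep_components]) (rule fl)
  then have "distr M (Pi\<^sub>M UNIV (\<lambda>_. ?P)) (\<lambda>\<omega>. \<lambda>i\<in>UNIV. fl (?X i \<omega>)) =
      (\<Pi>\<^sub>M i\<in>UNIV. distr M ?P (\<lambda>\<omega>. fl (?X i \<omega>)))"
    by (subst indep_vars_iff_distr_eq_PiM[symmetric]) (use flX in auto)
  also have "\<dots> = (\<Pi>\<^sub>M i\<in>UNIV. distr M ?P (?X i))"
    unfolding fl_X using brownian_flip_law[OF prob_space_axioms brownian_component assms] by simp
  also have "\<dots> = distr M (Pi\<^sub>M UNIV (\<lambda>_. ?P)) (\<lambda>\<omega>. \<lambda>i\<in>UNIV. ?X i \<omega>)"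
    using indep_components by (subst indep_vars_iff_distr_eq_PiM[THEN iffD1]) (use X in auto)
  finally have "distr (distr M (Pi\<^sub>M UNIV (\<lambda>_. ?P)) (\<lambda>\<omega>. \<lambda>i\<in>UNIV. fl (?X i \<omega>))) path_space vec =
      distr (distr M (Pi\<^sub>M UNIV (\<lambda>_. ?P)) (\<lambda>\<omega>. \<lambda>i\<in>UNIV. ?X i \<omega>)) path_space vec"
    by simp
  then have "distr M path_space (\<lambda>\<omega>. vec (\<lambda>i\<in>UNIV. fl (?X i \<omega>))) =
      distr M path_space (\<lambda>\<omega>. vec (\<lambda>i\<in>UNIV. ?X i \<omega>))"
    by (subst (asm) (1 2) distr_distr)
      (use X flX vec in \<open>auto simp: comp_def simp del: restrict_apply intro!: measurable_restrict\<close>)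
  moreover have "vec (\<lambda>i\<in>UNIV. fl (?X i \<omega>)) = reflected_noise q \<omega>" for \<omega>
    unfolding fl_X by (auto simp: vec_def reflected_noise_def fun_eq_iff vec_eq_iff)
  moreover have "vec (\<lambda>i\<in>UNIV. ?X i \<omega>) = (\<lambda>s\<in>{0..}. v s \<omega>)" for \<omega>
    by (auto simp: vec_def fun_eq_iff vec_eq_iff)
  ultimately show ?thesis by simp
qed

text \<open>An event of the filtration at \<open>q\<close> is decided by the path up to
  \<open>q\<close>, where the noise and its reflection coincide. A single path event therefore
  describes it for both, which expresses that the reflection does not disturb the past.\<close>

lemma history_path_representation:
  assumes "0 \<le> q" "B \<in> sets (noise_filtration M v q)"
  shows "\<exists>C\<in>sets path_space. \<forall>\<omega>\<in>space M. ((\<lambda>s\<in>{0..}. v s \<omega>) \<in> C \<longleftrightarrow> \<omega> \<in> B) \<and>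
    (reflected_noise q \<omega> \<in> C \<longleftrightarrow> \<omega> \<in> B)"
  using assms(2) unfolding sets_noise_filtration
proof (induction rule: sigma_sets.induct)
  case (Basic B)
  then obtain s i A where B: "B = (\<lambda>\<omega>. v s \<omega> $ i) -` A \<inter> space M" and s: "0 \<le> s" "s \<le> q"
    and "A \<in> sets borel" by blast
  have "(\<lambda>w. w s $ i) \<in> borel_measurable (path_space :: (real \<Rightarrow> real ^ 'n) measure)"
    by (rule measurable_compose[where f = "\<lambda>w. w s" and g = "\<lambda>x. x $ i" and N = borel]) (use s in auto)
  from measurable_sets[OF this \<open>A \<in> sets borel\<close>] show ?case
  proof (rule bexI[rotated], intro ballI)
    fix \<omega> assume "\<omega> \<in> space M"
    have "(\<lambda>s\<in>{0..}. v s \<omega>) \<in> space path_space" "reflected_noise q \<omega> \<in> space path_space"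
      by (auto simp: space_PiM reflected_noise_def)
    then show "((\<lambda>s\<in>{0..}. v s \<omega>) \<in> (\<lambda>w. w s $ i) -` A \<inter> space path_space \<longleftrightarrow> \<omega> \<in> B) \<and>
        (reflected_noise q \<omega> \<in> (\<lambda>w. w s $ i) -` A \<inter> space path_space \<longleftrightarrow> \<omega> \<in> B)"
      using s \<open>\<omega> \<in> space M\<close> by (simp add: B reflected_noise_def)
  qed
next
  case Empty
  show ?case by (rule bexI[of _ "{}"]) auto
next
  case (Compl B)
  then obtain C where C: "C \<in> sets path_space" "\<forall>\<omega>\<in>space M. ((\<lambda>s\<in>{0..}. v s \<omega>) \<in> C \<longleftrightarrow> \<omega> \<in> B) \<and>
    (reflected_noise q \<omega> \<in> C \<longleftrightarrow> \<omega> \<in> B)" by blast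
  have "space path_space - C \<in> sets path_space" using C(1) by auto
  then show ?case
  proof (rule bexI[rotated], intro ballI)
    fix \<omega> assume "\<omega> \<in> space M"
    have "(\<lambda>s\<in>{0..}. v s \<omega>) \<in> space path_space" "reflected_noise q \<omega> \<in> space path_space"
      by (auto simp: space_PiM reflected_noise_def)
    then show "((\<lambda>s\<in>{0..}. v s \<omega>) \<in> space path_space - C \<longleftrightarrow> \<omega> \<in> space M - B) \<and>
        (reflected_noise q \<omega> \<in> space path_space - C \<longleftrightarrow> \<omega> \<in> space M - B)"
      using C(2) \<open>\<omega> \<in> space M\<close> by blast
  qed
next
  case (Union B)
  then have "\<forall>i. \<exists>C\<in>sets path_space. \<forall>\<omega>\<in>space M. ((\<lambda>s\<in>{0..}. v s \<omega>) \<in> C \<longleftrightarrow> \<omega> \<in> B i) \<and>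
    (reflected_noise q \<omega> \<in> C \<longleftrightarrow> \<omega> \<in> B i)" by blast
  then obtain C where C: "\<And>i::nat. C i \<in> sets path_space"
    "\<And>i. \<forall>\<omega>\<in>space M. ((\<lambda>s\<in>{0..}. v s \<omega>) \<in> C i \<longleftrightarrow> \<omega> \<in> B i) \<and> (reflected_noise q \<omega> \<in> C i \<longleftrightarrow> \<omega> \<in> B i)"
    by metis
  have "(\<Union>i. C i) \<in> sets path_space" using C(1) by auto
  then show ?case
  proof (rule bexI[rotated], intro ballI)
    fix \<omega> assume "\<omega> \<in> space M"
    then show "((\<lambda>s\<in>{0..}. v s \<omega>) \<in> (\<Union>i. C i) \<longleftrightarrow> \<omega> \<in> (\<Union>i. B i)) \<and>
        (reflected_noise q \<omega> \<in> (\<Union>i. C i) \<longleftrightarrow> \<omega> \<in> (\<Union>i. B i))"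
      using C(2) by blast
  qed
qed

text \<open>Both sides are the probability of one path event \<open>D\<close>, taken for the noise
  and for its reflection at \<open>q\<close>: \<open>D\<close> combines the past event
  \<open>B\<close> with the condition that the restarted path lies in \<open>C\<close>, and
  restarting the reflected noise gives the reflection of the restarted noise.\<close>

lemma emeasure_restart_symmetric_const:
  assumes "0 \<le> q" and B: "B \<in> sets (noise_filtration M v q)" and C: "C \<in> sets path_space"
  shows "emeasure M {\<omega> \<in> B. restarted_noise v (\<lambda>_. q) \<omega> \<in> C} =
    emeasure M {\<omega> \<in> B. reflect_path (restarted_noise v (\<lambda>_. q) \<omega>) \<in> C}"
proof -
  obtain C' where C': "C' \<in> sets path_space" "\<And>\<omega>. \<omega> \<in> space M \<Longrightarrow> (\<lambda>s\<in>{0..}. v s \<omega>) \<in> C' \<longleftrightarrow> \<omega> \<in> B"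
    "\<And>\<omega>. \<omega> \<in> space M \<Longrightarrow> reflected_noise q \<omega> \<in> C' \<longleftrightarrow> \<omega> \<in> B"
    using history_path_representation[OF assms(1) B] by blast
  define R :: "(real \<Rightarrow> real ^ 'n) \<Rightarrow> real \<Rightarrow> real ^ 'n" where "R w = (\<lambda>s\<in>{0..}. w (q + s) - w q)" for w
  have R: "R \<in> measurable path_space path_space"
    unfolding R_def[abs_def] using assms(1)
    by (intro measurable_restrict borel_measurable_diff measurable_component_singleton) auto
  define D where "D = C' \<inter> (R -` C \<inter> space path_space)"
  have D: "D \<in> sets path_space"
    unfolding D_def using C'(1) measurable_sets[OF R C] by auto
  have B_sub: "B \<subseteq> space M"
    using sets.sets_into_space[OF B] by (simp add: space_F)
  have "R (\<lambda>s\<in>{0..}. v s \<omega>) = restarted_noise v (\<lambda>_. q) \<omega>" for \<omega>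
    using assms(1) by (auto simp: R_def restarted_noise_def fun_eq_iff)
  then have 1: "{\<omega> \<in> B. restarted_noise v (\<lambda>_. q) \<omega> \<in> C} = (\<lambda>\<omega>. \<lambda>s\<in>{0..}. v s \<omega>) -` D \<inter> space M"
    using B_sub C'(2) by (auto simp: D_def space_PiM)
  have "R (reflected_noise q \<omega>) = reflect_path (restarted_noise v (\<lambda>_. q) \<omega>)" if "\<omega> \<in> space M" for \<omega>
    using assms(1) by (auto simp: R_def restarted_noise_def reflected_noise_def reflect_path_def fun_eq_iff scaleR_2)
  then have 2: "{\<omega> \<in> B. reflect_path (restarted_noise v (\<lambda>_. q) \<omega>) \<in> C} = reflected_noise q -` D \<inter> space M"
    using B_sub C'(3) by (auto simp: D_def space_PiM reflected_noise_def)
  have "emeasure (distr M path_space (\<lambda>\<omega>. \<lambda>s\<in>{0..}. v s \<omega>)) D = emeasure (distr M path_space (reflected_noise q)) D"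
    using distr_reflected_noise[OF assms(1)] by simp
  then show ?thesis
    unfolding 1 2 using D measurable_noise_path measurable_reflected_noise[OF assms(1)]
    by (simp add: emeasure_distr)
qed

section \<open>Symmetry of the noise restarted at a stopping time\<close>

lemma measurable_restarted_noise:
  assumes S: "S \<in> borel_measurable M" "\<And>\<omega>. \<omega> \<in> space M \<Longrightarrow> 0 \<le> S \<omega>"
  shows "restarted_noise v S \<in> measurable M path_space"
proof -
  have "(\<lambda>\<omega>. v (S \<omega> + s) \<omega>) \<in> borel_measurable M" if "0 \<le> s" for s
    by (rule borel_measurable_at_random_time[where R = "\<lambda>\<omega>. S \<omega> + s", OF noise_measurable])
      (use S that noise_continuous in auto)
  from this this[of 0] show ?thesis
    unfolding restarted_noise_def[abs_def]
    by (intro measurable_restrict borel_measurable_diff) auto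
qed

text \<open>On each of countably many pieces the grid time is a fixed time. Since it is obtained by
  rounding up, each piece of \<open>B\<close> is an event known at that fixed time, so the statement
  for fixed times applies to every piece and the pieces are summed.\<close>

lemma emeasure_restart_symmetric_grid:
  assumes S: "stopping_time (noise_filtration M v) S" "\<And>\<omega>. \<omega> \<in> space M \<Longrightarrow> 0 \<le> S \<omega>"
    and B: "B \<in> sets (noise_history M v S)" and C: "C \<in> sets path_space"
  shows "emeasure M {\<omega> \<in> B. restarted_noise v (\<lambda>\<omega>. grid n (S \<omega>)) \<omega> \<in> C} =
    emeasure M {\<omega> \<in> B. reflect_path (restarted_noise v (\<lambda>\<omega>. grid n (S \<omega>)) \<omega>) \<in> C}"
proof -
  define \<kappa> where "\<kappa> \<omega> = nat \<lceil>real (Suc n) * S \<omega>\<rceil>" for \<omega>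
  define q where "q k = real k / real (Suc n)" for k
  define Bk where "Bk k = {\<omega> \<in> B. \<kappa> \<omega> = k}" for k
  have grid: "grid n (S \<omega>) = q (\<kappa> \<omega>)" for \<omega>
    by (simp add: grid_def q_def \<kappa>_def)
  have \<kappa>_le: "\<kappa> \<omega> \<le> k \<longleftrightarrow> S \<omega> \<le> q k" for \<omega> k
    unfolding \<kappa>_def q_def by (simp add: nat_ceiling_le_eq pos_le_divide_eq mult.commute del: of_nat_Suc)
  have Bk: "Bk k \<in> sets (noise_filtration M v (q k))" for k
  proof (cases k)
    case 0
    then have "Bk k = {\<omega> \<in> B. S \<omega> \<le> q k}" unfolding Bk_def using \<kappa>_le[of _ 0] by auto
    then show ?thesis using sets_pre_sigmaD[OF S(1) B] by simp
  next
    case (Suc j)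
    \<comment> \<open>The event that \<open>\<kappa>\<close> equals \<open>Suc j\<close> is the
      difference of two events of the form \<open>\<kappa> \<omega> \<le> i\<close>, both known at
      \<open>q k\<close>.\<close>
    have "Bk k = {\<omega> \<in> B. S \<omega> \<le> q k} - {\<omega> \<in> B. S \<omega> \<le> q j}"
      unfolding Bk_def \<kappa>_le[symmetric] using Suc by auto
    moreover have "q j \<le> q k" using Suc by (simp add: q_def divide_right_mono)
    then have "{\<omega> \<in> B. S \<omega> \<le> q j} \<in> sets (noise_filtration M v (q k))"
      using sets_pre_sigmaD[OF S(1) B, of "q j"] sets_F_mono by blast
    ultimately show ?thesis using sets_pre_sigmaD[OF S(1) B, of "q k"] by auto
  qed
  have Bk_M: "Bk k \<in> sets M" for k using Bk sets_noise_filtration_subset by blast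
  have split: "emeasure M {\<omega> \<in> B. f (restarted_noise v (\<lambda>\<omega>. grid n (S \<omega>)) \<omega>) \<in> C} =
      (\<Sum>k. emeasure M {\<omega> \<in> Bk k. f (restarted_noise v (\<lambda>_. q k) \<omega>) \<in> C})"
    if f: "f \<in> measurable path_space path_space" for f
  proof -
    have eq: "restarted_noise v (\<lambda>\<omega>. grid n (S \<omega>)) \<omega> = restarted_noise v (\<lambda>_. q k) \<omega>" if "\<omega> \<in> Bk k" for k \<omega>
      using that by (simp add: Bk_def restarted_noise_def grid)
    have "{\<omega> \<in> B. f (restarted_noise v (\<lambda>\<omega>. grid n (S \<omega>)) \<omega>) \<in> C} =
        (\<Union>k. {\<omega> \<in> Bk k. f (restarted_noise v (\<lambda>_. q k) \<omega>) \<in> C})"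
    proof -
      have "B = (\<Union>k. Bk k)" by (auto simp: Bk_def)
      then show ?thesis using eq by auto
    qed
    moreover have "{\<omega> \<in> Bk k. f (restarted_noise v (\<lambda>_. q k) \<omega>) \<in> C} \<in> sets M" for k
    proof -
      have "restarted_noise v (\<lambda>_. q k) \<in> measurable M path_space"
        by (rule measurable_restarted_noise) (auto simp: q_def)
      then have "(\<lambda>\<omega>. f (restarted_noise v (\<lambda>_. q k) \<omega>)) -` C \<inter> space M \<in> sets M"
        by (intro measurable_sets[OF _ C] measurable_compose[OF _ f])
      then have "Bk k \<inter> ((\<lambda>\<omega>. f (restarted_noise v (\<lambda>_. q k) \<omega>)) -` C \<inter> space M) \<in> sets M"
        using Bk_M by auto
      also have "Bk k \<inter> ((\<lambda>\<omega>. f (restarted_noise v (\<lambda>_. q k) \<omega>)) -` C \<inter> space M) =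
          {\<omega> \<in> Bk k. f (restarted_noise v (\<lambda>_. q k) \<omega>) \<in> C}"
        using sets.sets_into_space[OF Bk_M] by auto
      finally show ?thesis .
    qed
    moreover have "disjoint_family (\<lambda>k. {\<omega> \<in> Bk k. f (restarted_noise v (\<lambda>_. q k) \<omega>) \<in> C})"
      by (auto simp: disjoint_family_on_def Bk_def)
    ultimately show ?thesis by (simp add: suminf_emeasure[symmetric] image_subset_iff)
  qed
  have "q k \<ge> 0" for k by (simp add: q_def)
  then show ?thesis
    using split[of "\<lambda>w. w"] split[of reflect_path] emeasure_restart_symmetric_const[OF _ Bk C] by simp
qed

lemma sets_noise_history_subset:
  assumes S: "stopping_time (noise_filtration M v) S"
  shows "sets (noise_history M v S) \<subseteq> sets M"
proof
  fix B assume B: "B \<in> sets (noise_history M v S)"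
  have "{\<omega> \<in> B. S \<omega> \<le> real n} \<in> sets M" for n
    using sets_pre_sigmaD[OF S B] sets_noise_filtration_subset by blast
  then have "(\<Union>n. {\<omega> \<in> B. S \<omega> \<le> real n}) \<in> sets M" by blast
  also have "(\<Union>n. {\<omega> \<in> B. S \<omega> \<le> real n}) = B"
    using real_arch_simple by auto
  finally show "B \<in> sets M" .
qed

text \<open>Conditioning on \<open>B\<close> without normalization. The name is qualified because
  plain \<open>density\<close> denotes the field of the control record.\<close>

abbreviation restricted_measure :: "'a set \<Rightarrow> 'a measure" where
  "restricted_measure B \<equiv> Nonnegative_Lebesgue_Integration.density M (indicator B)"

text \<open>As the grid becomes finer, the paths restarted at grid times converge at every
  coordinate by continuity of the noise. The event \<open>B\<close> stays fixed during the limit,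
  and the symmetry of the laws under the restricted measure is inherited.\<close>

lemma distr_restart_symmetric:
  assumes S: "stopping_time (noise_filtration M v) S" "\<And>\<omega>. \<omega> \<in> space M \<Longrightarrow> 0 \<le> S \<omega>"
    and B: "B \<in> sets (noise_history M v S)"
  shows "distr (restricted_measure B) path_space (restarted_noise v S) =
    distr (restricted_measure B) path_space (\<lambda>\<omega>. reflect_path (restarted_noise v S \<omega>))"
proof -
  define N where "N = restricted_measure B"
  have B_M: "B \<in> sets M" using B sets_noise_history_subset[OF S(1)] by blast
  have sets_N: "sets N = sets M" and space_N: "space N = space M" by (auto simp: N_def)
  interpret N: finite_measure N
    unfolding N_def by (rule finite_measure_restricted[OF B_M])
  have emN: "emeasure N A = emeasure M (B \<inter> A)" if "A \<in> sets M" for A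
    unfolding N_def using emeasure_restricted[OF B_M that] by simp
  define W where "W T = restarted_noise v T" for T
  have W: "W T \<in> measurable N path_space"
    if "T \<in> borel_measurable M" "\<And>\<omega>. \<omega> \<in> space M \<Longrightarrow> 0 \<le> T \<omega>" for T
    using measurable_restarted_noise[OF that] unfolding W_def by (simp add: measurable_cong_sets[OF sets_N refl])
  have S_M: "S \<in> borel_measurable M"
    by (rule measurable_stopping_time[OF S(1) sets_noise_filtration_subset]) (simp add: space_F)
  have WS: "W S \<in> measurable N path_space" by (rule W[OF S_M S(2)])
  define Sn where "Sn n \<omega> = grid n (S \<omega>)" for n \<omega>
  have Sn: "Sn n \<in> borel_measurable M" for n
    unfolding Sn_def by (rule measurable_at_grid_time[OF _ S_M]) auto
  have WSn: "W (Sn n) \<in> measurable N path_space" for n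
    by (rule W[OF Sn]) (auto simp: Sn_def grid_nonneg)
  have rWS: "(\<lambda>\<omega>. reflect_path (W S \<omega>)) \<in> measurable N path_space"
    by (rule measurable_compose[OF WS measurable_reflect_path])
  have rWSn: "(\<lambda>\<omega>. reflect_path (W (Sn n) \<omega>)) \<in> measurable N path_space" for n
    by (rule measurable_compose[OF WSn measurable_reflect_path])
  have law_n: "distr N path_space (W (Sn n)) = distr N path_space (\<lambda>\<omega>. reflect_path (W (Sn n) \<omega>))" for n
  proof (rule measure_eqI)
    fix C assume "C \<in> sets (distr N path_space (W (Sn n)))"
    then have C: "C \<in> sets path_space" by simp
    have B_sub: "B \<subseteq> space M" using sets.sets_into_space[OF B_M] .
    have *: "emeasure N (f -` C \<inter> space N) = emeasure M {\<omega> \<in> B. f \<omega> \<in> C}"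
      if "f \<in> measurable N path_space" for f
    proof -
      have "f -` C \<inter> space N \<in> sets M" using measurable_sets[OF that C] sets_N by simp
      then have "emeasure N (f -` C \<inter> space N) = emeasure M (B \<inter> (f -` C \<inter> space N))" by (rule emN)
      also have "B \<inter> (f -` C \<inter> space N) = {\<omega> \<in> B. f \<omega> \<in> C}" using B_sub space_N by auto
      finally show ?thesis .
    qed
    show "emeasure (distr N path_space (W (Sn n))) C =
        emeasure (distr N path_space (\<lambda>\<omega>. reflect_path (W (Sn n) \<omega>))) C"
      unfolding emeasure_distr[OF WSn C] emeasure_distr[OF rWSn C] *[OF WSn] *[OF rWSn]
      using emeasure_restart_symmetric_grid[OF S B C, of n] by (simp add: W_def Sn_def[abs_def])
  qed simp
  have W_tendsto: "(\<lambda>n. W (Sn n) \<omega> j) \<longlonglongrightarrow> W S \<omega> j" if "\<omega> \<in> space M" "0 \<le> j" for \<omega> j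
  proof -
    have "(\<lambda>n. v (grid n (S \<omega>) + r) \<omega>) \<longlonglongrightarrow> v (S \<omega> + r) \<omega>" if "0 \<le> r" for r
      using noise_continuous[OF \<open>\<omega> \<in> space M\<close>] S(2)[OF \<open>\<omega> \<in> space M\<close>] that
      by (intro continuous_on_tendsto_compose[where f = "\<lambda>s. v s \<omega>" and s = "{0..}"]
          tendsto_add tendsto_const grid_tendsto) (auto simp: grid_nonneg)
    from tendsto_diff[OF this[OF \<open>0 \<le> j\<close>] this[of 0]] show ?thesis
      using \<open>0 \<le> j\<close> by (simp add: W_def Sn_def restarted_noise_def)
  qed
  have "distr N path_space (W S) = distr N path_space (\<lambda>\<omega>. reflect_path (W S \<omega>))"
  proof (rule PiM_borel_eqI_continuous[where I = "{0..}"])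
    fix J :: "real set" and \<phi> :: "real \<Rightarrow> real ^ 'n \<Rightarrow> real"
    assume J: "finite J" "J \<subseteq> {0..}" and cont: "\<And>j. continuous_on UNIV (\<phi> j)"
      and \<phi>: "\<And>j x. 0 \<le> \<phi> j x" "\<And>j x. \<phi> j x \<le> 1"
    define f where "f w = (\<Prod>j\<in>J. \<phi> j (w j))" for w
    have f: "f \<in> borel_measurable path_space"
      unfolding f_def
    proof (rule borel_measurable_prod)
      fix j assume "j \<in> J"
      then have [measurable]: "j \<in> {0..}" using J by auto
      have [measurable]: "\<phi> j \<in> borel_measurable borel" by (rule borel_measurable_continuous_onI[OF cont])
      show "(\<lambda>w. \<phi> j (w j)) \<in> borel_measurable path_space" by measurable
    qed
    \<comment> \<open>One convergence statement serves both limits, that of the restarted paths and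
      that of their reflections.\<close>
    have lim: "(\<lambda>n. \<integral>w. f w \<partial>distr N path_space (X n)) \<longlonglongrightarrow> (\<integral>w. f w \<partial>distr N path_space Y)"
      if X: "\<And>n. X n \<in> measurable N path_space" and Y: "Y \<in> measurable N path_space"
        and XY: "\<And>\<omega> j. \<omega> \<in> space M \<Longrightarrow> 0 \<le> j \<Longrightarrow> (\<lambda>n. X n \<omega> j) \<longlonglongrightarrow> Y \<omega> j" for X Y
      unfolding integral_distr[OF X f] integral_distr[OF Y f]
    proof (rule integral_dominated_convergence[where w = "\<lambda>_. 1"])
      show "(\<lambda>\<omega>. f (Y \<omega>)) \<in> borel_measurable N" by (rule measurable_compose[OF Y f])
      show "(\<lambda>\<omega>. f (X n \<omega>)) \<in> borel_measurable N" for n by (rule measurable_compose[OF X f])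
      show "integrable N (\<lambda>_. 1 :: real)" by simp
      show "AE \<omega> in N. (\<lambda>n. f (X n \<omega>)) \<longlonglongrightarrow> f (Y \<omega>)"
      proof (rule AE_I2)
        fix \<omega> assume "\<omega> \<in> space N"
        then show "(\<lambda>n. f (X n \<omega>)) \<longlonglongrightarrow> f (Y \<omega>)"
          unfolding f_def using J space_N
          by (intro tendsto_prod continuous_on_tendsto_compose[OF cont] XY) auto
      qed
      have "norm (f w) \<le> 1" for w
        unfolding f_def using \<phi> by (auto simp: abs_prod intro!: prod_le_1)
      then show "AE \<omega> in N. norm (f (X n \<omega>)) \<le> 1" for n by simp
    qed
    have "(\<integral>w. f w \<partial>distr N path_space (W S)) = (\<integral>w. f w \<partial>distr N path_space (\<lambda>\<omega>. reflect_path (W S \<omega>)))"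
    proof (rule LIMSEQ_unique)
      show "(\<lambda>n. \<integral>w. f w \<partial>distr N path_space (W (Sn n))) \<longlonglongrightarrow> (\<integral>w. f w \<partial>distr N path_space (W S))"
        by (rule lim[OF WSn WS W_tendsto])
      show "(\<lambda>n. \<integral>w. f w \<partial>distr N path_space (W (Sn n))) \<longlonglongrightarrow>
          (\<integral>w. f w \<partial>distr N path_space (\<lambda>\<omega>. reflect_path (W S \<omega>)))"
        unfolding law_n
        by (rule lim[OF rWSn rWS]) (auto simp: reflect_path_def intro!: tendsto_minus W_tendsto)
    qed
    then show "(\<integral>w. (\<Prod>j\<in>J. \<phi> j (w j)) \<partial>distr N path_space (W S)) =
        (\<integral>w. (\<Prod>j\<in>J. \<phi> j (w j)) \<partial>distr N path_space (\<lambda>\<omega>. reflect_path (W S \<omega>)))"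
      unfolding f_def .
  qed (simp_all add: N.finite_measure_distr[OF WS] N.finite_measure_distr[OF rWS])
  then show ?thesis unfolding N_def W_def .
qed

text \<open>Keeping the outcome itself as first component, with the history as its \<sigma>-algebra,
  covers all quantities determined by the history at once. On a rectangle
  \<open>B \<times> C\<close> the equality is that of the laws under the measure restricted to
  \<open>B\<close>, and rectangles form an intersection stable generator.\<close>

lemma distr_history_restart_symmetric:
  assumes S: "stopping_time (noise_filtration M v) S" "\<And>\<omega>. \<omega> \<in> space M \<Longrightarrow> 0 \<le> S \<omega>"
  defines "L \<equiv> noise_history M v S \<Otimes>\<^sub>M path_space"
  shows "(\<lambda>\<omega>. (\<omega>, restarted_noise v S \<omega>)) \<in> measurable M L"
    and "(\<lambda>\<omega>. (\<omega>, reflect_path (restarted_noise v S \<omega>))) \<in> measurable M L"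
    and "distr M L (\<lambda>\<omega>. (\<omega>, restarted_noise v S \<omega>)) =
      distr M L (\<lambda>\<omega>. (\<omega>, reflect_path (restarted_noise v S \<omega>)))"
proof -
  let ?H = "noise_history M v S" and ?W = "restarted_noise v S"
  let ?rW = "\<lambda>\<omega>. reflect_path (?W \<omega>)"
  have S_M: "S \<in> borel_measurable M"
    by (rule measurable_stopping_time[OF S(1) sets_noise_filtration_subset]) (simp add: space_F)
  have W: "?W \<in> measurable M path_space" by (rule measurable_restarted_noise[OF S_M S(2)])
  have rW: "?rW \<in> measurable M path_space" by (rule measurable_compose[OF W measurable_reflect_path])
  have "(\<lambda>\<omega>. \<omega>) \<in> measurable M ?H"
    using sets_noise_history_subset[OF S(1)] by (intro measurableI) (auto simp: space_pre_sigma dest: sets.sets_into_space)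
  then show 1: "(\<lambda>\<omega>. (\<omega>, ?W \<omega>)) \<in> measurable M L" and 2: "(\<lambda>\<omega>. (\<omega>, ?rW \<omega>)) \<in> measurable M L"
    unfolding L_def using W rW by (auto intro!: measurable_Pair)
  let ?G = "{a \<times> b | a b. a \<in> sets ?H \<and> b \<in> sets (path_space :: (real \<Rightarrow> real ^ 'n) measure)}"
  show "distr M L (\<lambda>\<omega>. (\<omega>, ?W \<omega>)) = distr M L (\<lambda>\<omega>. (\<omega>, ?rW \<omega>))"
  proof (rule measure_eqI_generator_eq[of ?G "space ?H \<times> space path_space" _ _ "\<lambda>_. space ?H \<times> space path_space"])
    show "Int_stable ?G" by (rule Int_stable_pair_measure_generator)
    show "?G \<subseteq> Pow (space ?H \<times> space path_space)"
      by (auto dest!: sets.sets_into_space)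
    fix X assume "X \<in> ?G"
    then obtain B C where X: "X = B \<times> C" and B: "B \<in> sets ?H" and C: "C \<in> sets path_space" by blast
    have B_M: "B \<in> sets M" using B sets_noise_history_subset[OF S(1)] by blast
    have X_L: "X \<in> sets L" unfolding X L_def using B C by auto
    have *: "emeasure (distr M L (\<lambda>\<omega>. (\<omega>, f \<omega>))) X = emeasure (distr (restricted_measure B) path_space f) C"
      if f: "f \<in> measurable M path_space" and fL: "(\<lambda>\<omega>. (\<omega>, f \<omega>)) \<in> measurable M L" for f
    proof -
      have "f \<in> measurable (restricted_measure B) path_space" using f by simp
      then have "emeasure (distr (restricted_measure B) path_space f) C =
          emeasure (restricted_measure B) (f -` C \<inter> space M)"
        using C by (simp add: emeasure_distr)
      also have "\<dots> = emeasure M (B \<inter> (f -` C \<inter> space M))"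
        by (rule emeasure_restricted[OF B_M measurable_sets[OF f C]])
      also have "B \<inter> (f -` C \<inter> space M) = (\<lambda>\<omega>. (\<omega>, f \<omega>)) -` X \<inter> space M"
        unfolding X by auto
      finally show ?thesis using emeasure_distr[OF fL X_L] by simp
    qed
    show "emeasure (distr M L (\<lambda>\<omega>. (\<omega>, ?W \<omega>))) X = emeasure (distr M L (\<lambda>\<omega>. (\<omega>, ?rW \<omega>))) X"
      unfolding *[OF W 1] *[OF rW 2] using distr_restart_symmetric[OF S B] by simp
  next
    show "emeasure (distr M L (\<lambda>\<omega>. (\<omega>, ?W \<omega>))) (space ?H \<times> space path_space) \<noteq> \<infinity>"
      using prob_space_distr[OF 1] prob_space.emeasure_le_1 by (metis ennreal_one_neq_top infinity_ennreal_def neq_top_trans)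
  qed (auto simp: L_def sets_pair_measure)
qed

end

section \<open>The cost of a stage\<close>

text \<open>Symmetry of \<open>E\<close> pairs every edge with its reverse, which allows completing
  the square; the factor 1/2 compensates for counting both orientations.\<close>

lemma laplacian_form_eq:
  fixes x :: "real ^ 'n::finite"
  assumes "sym E"
  shows "x \<bullet> (laplacian E *v x) = (\<Sum>i\<in>UNIV. \<Sum>j\<in>UNIV. of_bool ((i, j) \<in> E) * (x $ i - x $ j)\<^sup>2) / 2"
proof -
  define e :: "'n \<Rightarrow> 'n \<Rightarrow> real" where "e i j = of_bool ((i, j) \<in> E)" for i j
  have e_sym: "e i j = e j i" for i j
    using assms by (auto simp: e_def sym_def)
  have deg: "real (card {l. (i, l) \<in> E}) = (\<Sum>j\<in>UNIV. e i j)" for i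
    by (simp add: e_def sum_of_bool_eq)
  have entry: "laplacian E $ i $ j = (if i = j then \<Sum>j\<in>UNIV. e i j else 0) - e i j" for i j
  proof -
    have "adjacency_matrix E $ i $ j = e i j" by (simp add: adjacency_matrix_def e_def)
    then show ?thesis by (simp add: laplacian_def degree_matrix_def deg)
  qed
  have row: "(laplacian E *v x) $ i = (\<Sum>j\<in>UNIV. e i j * (x $ i - x $ j))" for i
  proof -
    have "(laplacian E *v x) $ i = (\<Sum>j\<in>UNIV. (if i = j then (\<Sum>j\<in>UNIV. e i j) * x $ j else 0) - e i j * x $ j)"
      unfolding matrix_vector_mult_def by (auto simp: entry left_diff_distrib intro!: sum.cong)
    also have "\<dots> = (\<Sum>j\<in>UNIV. e i j) * x $ i - (\<Sum>j\<in>UNIV. e i j * x $ j)"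
      by (simp add: sum_subtractf)
    also have "\<dots> = (\<Sum>j\<in>UNIV. e i j * (x $ i - x $ j))"
      by (simp add: sum_subtractf sum_distrib_right right_diff_distrib)
    finally show ?thesis .
  qed
  have *: "x \<bullet> (laplacian E *v x) = (\<Sum>i\<in>UNIV. \<Sum>j\<in>UNIV. e i j * (x $ i * (x $ i - x $ j)))"
    unfolding inner_vec_def row by (simp add: sum_distrib_left mult_ac)
  \<comment> \<open>The same form with \<open>i\<close> and \<open>j\<close> exchanged; the sum of
    the two versions consists of squares.\<close>
  also have "\<dots> = (\<Sum>i\<in>UNIV. \<Sum>j\<in>UNIV. e i j * (x $ j * (x $ j - x $ i)))"
    by (subst sum.swap) (simp add: e_sym)
  finally have "2 * (x \<bullet> (laplacian E *v x)) = (\<Sum>i\<in>UNIV. \<Sum>j\<in>UNIV. e i j * (x $ i * (x $ i - x $ j))) +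
      (\<Sum>i\<in>UNIV. \<Sum>j\<in>UNIV. e i j * (x $ j * (x $ j - x $ i)))"
    using * by simp
  also have "\<dots> = (\<Sum>i\<in>UNIV. \<Sum>j\<in>UNIV. e i j * (x $ i - x $ j)\<^sup>2)"
    unfolding sum.distrib[symmetric]
    by (intro sum.cong refl) (simp add: power2_eq_square algebra_simps)
  finally show ?thesis by (simp add: e_def)
qed

lemma laplacian_form_nonneg: "sym E \<Longrightarrow> 0 \<le> (x :: real ^ 'n::finite) \<bullet> (laplacian E *v x)"
  by (simp add: laplacian_form_eq sum_nonneg)

lemma laplacian_form_shift:
  fixes x y :: "real ^ 'n::finite"
  assumes "sym E" "\<And>i. y $ i = x $ i + a"
  shows "y \<bullet> (laplacian E *v y) = x \<bullet> (laplacian E *v x)"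
  by (simp add: laplacian_form_eq assms)

text \<open>By bilinearity the mixed terms of the two summands are opposite, so they cancel
  pointwise.\<close>

lemma laplacian_form_parallelogram:
  fixes x y :: "real ^ 'n::finite"
  shows "(x + y) \<bullet> (laplacian E *v (x + y)) + (- x + y) \<bullet> (laplacian E *v (- x + y)) =
    2 * (x \<bullet> (laplacian E *v x)) + 2 * (y \<bullet> (laplacian E *v y))"
proof -
  have "laplacian E *v (- x) = - (laplacian E *v x)"
    using matrix_vector_mult_diff_distrib[of "laplacian E" 0 x] by simp
  then show ?thesis
    by (simp add: matrix_vector_right_distrib matrix_vector_mult_diff_distrib inner_add_left inner_add_right
        inner_diff_left inner_diff_right)
qed

lemma borel_measurable_laplacian_form [measurable]:
  "(\<lambda>x :: real ^ 'n::finite. x \<bullet> (laplacian E *v x)) \<in> borel_measurable borel"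
  by (intro borel_measurable_continuous_onI continuous_intros matrix_vector_mult_linear_continuous_on)

context brownian_noise
begin

lemma measurable_from_noise_history:
  assumes "stopping_time (noise_filtration M v) S" "f \<in> measurable (noise_history M v S) N"
  shows "f \<in> measurable M N"
  by (rule measurable_from_subalg[OF _ assms(2)])
    (simp add: subalgebra_def space_pre_sigma sets_noise_history_subset[OF assms(1)])

lemma noise_at_random_time:
  assumes "S \<in> borel_measurable M" "\<And>\<omega>. \<omega> \<in> space M \<Longrightarrow> 0 \<le> S \<omega>"
  shows "(\<lambda>\<omega>. v (S \<omega>) \<omega>) \<in> borel_measurable M"
  by (rule borel_measurable_at_random_time[OF noise_measurable])
    (use assms noise_continuous in auto)

lemma stage_cost_minimal:
  assumes "sym E" and s: "0 \<le> s"
    and S: "stopping_time (noise_filtration M v) S" "\<And>\<omega>. \<omega> \<in> space M \<Longrightarrow> 0 \<le> S \<omega>"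
    and T: "symmetric_stopping_time M v S T"
    and y: "y \<in> borel_measurable (noise_history M v S)"
  defines "Q \<equiv> \<lambda>x. x \<bullet> (laplacian E *v x)"
  shows "(\<integral>\<^sup>+\<omega>. (if S \<omega> \<le> s \<and> s < T \<omega> then ennreal (Q (v s \<omega> - v (S \<omega>) \<omega>)) else 0) \<partial>M)
    \<le> (\<integral>\<^sup>+\<omega>. (if S \<omega> \<le> s \<and> s < T \<omega> then ennreal (Q (v s \<omega> - v (S \<omega>) \<omega> + y \<omega>)) else 0) \<partial>M)"
proof -
  let ?H = "noise_history M v S" and ?W = "restarted_noise v S"
  let ?L = "?H \<Otimes>\<^sub>M path_space :: ('a \<times> (real \<Rightarrow> real ^ 'n)) measure"
  obtain \<tau> :: "'a \<Rightarrow> (real \<Rightarrow> real ^ 'n) \<Rightarrow> real" where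
    \<tau>[measurable]: "(\<lambda>(\<omega>, w). \<tau> \<omega> w) \<in> borel_measurable ?L"
    and T_eq: "\<And>\<omega>. \<omega> \<in> space M \<Longrightarrow> T \<omega> = S \<omega> + \<tau> \<omega> (?W \<omega>)"
    and \<tau>_sym: "\<And>\<omega> w. \<omega> \<in> space M \<Longrightarrow> w \<in> space path_space \<Longrightarrow> \<tau> \<omega> (reflect_path w) = \<tau> \<omega> w"
    using T unfolding symmetric_stopping_time_def reflect_path_def by blast
  have S_H[measurable]: "S \<in> borel_measurable ?H" by (rule measurable_stopping_time_pre_sigma[OF S(1)])
  have S_M: "S \<in> borel_measurable M" by (rule measurable_from_noise_history[OF S(1) S_H])
  have W: "?W \<in> measurable M path_space" by (rule measurable_restarted_noise[OF S_M S(2)])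
  \<comment> \<open>Evaluating a path at the random time \<open>s - S \<omega>\<close> is not measurable for the product
    \<open>\<sigma>\<close>-algebra; the limit along grid times is, and agrees with it on continuous paths.\<close>
  define incr :: "'a \<Rightarrow> (real \<Rightarrow> real ^ 'n) \<Rightarrow> real ^ 'n" where
    "incr \<omega> w = lim (\<lambda>n. w (grid n (s - S \<omega>)))" for \<omega> w
  have incr[measurable]: "(\<lambda>(\<omega>, w). incr \<omega> w) \<in> borel_measurable ?L"
  proof -
    have "(\<lambda>p. snd p (grid n (s - S (fst p)))) \<in> borel_measurable ?L" for n
      by (rule measurable_at_grid_time[where X = "\<lambda>r p. snd p r"])
        (auto intro!: measurable_compose[OF measurable_snd measurable_component_singleton])
    then have "(\<lambda>p. lim (\<lambda>n. snd p (grid n (s - S (fst p))))) \<in> borel_measurable ?L"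
      by (rule borel_measurable_lim_metric)
    then show ?thesis by (simp add: incr_def split_def)
  qed
  have incr_tendsto: "(\<lambda>n. ?W \<omega> (grid n (s - S \<omega>))) \<longlonglongrightarrow> v s \<omega> - v (S \<omega>) \<omega>"
    if "\<omega> \<in> space M" "S \<omega> \<le> s" for \<omega>
  proof -
    have "(\<lambda>n. v (S \<omega> + grid n (s - S \<omega>)) \<omega>) \<longlonglongrightarrow> v (S \<omega> + (s - S \<omega>)) \<omega>"
      using noise_continuous[OF that(1)] S(2)[OF that(1)] that(2) s
      by (intro continuous_on_tendsto_compose[where f = "\<lambda>s. v s \<omega>" and s = "{0..}"]
          tendsto_add tendsto_const grid_tendsto) (auto simp: grid_nonneg)
    then show ?thesis
      by (simp add: restarted_noise_def grid_nonneg tendsto_diff)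
  qed
  have incr_W: "incr \<omega> (?W \<omega>) = v s \<omega> - v (S \<omega>) \<omega>"
    and incr_rW: "incr \<omega> (reflect_path (?W \<omega>)) = - (v s \<omega> - v (S \<omega>) \<omega>)"
    if "\<omega> \<in> space M" "S \<omega> \<le> s" for \<omega>
    unfolding incr_def using limI[OF incr_tendsto[OF that]] limI[OF tendsto_minus[OF incr_tendsto[OF that]]]
    by (simp_all add: reflect_path_def grid_nonneg)
  \<comment> \<open>The stage cost as a function of outcome and path, measurable for history and
    path space, so that the law of the pair determines its integral. Where \<open>S\<close> exceeds
    \<open>s\<close> the value of \<open>incr\<close> is meaningless, and the condition masks
    it.\<close>
  define \<Phi> :: "('a \<Rightarrow> real ^ 'n) \<Rightarrow> 'a \<times> (real \<Rightarrow> real ^ 'n) \<Rightarrow> ennreal" where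
    "\<Phi> z p = (if S (fst p) \<le> s \<and> s < S (fst p) + \<tau> (fst p) (snd p)
      then ennreal (Q (incr (fst p) (snd p) + z (fst p))) else 0)" for z p
  have \<Phi>: "\<Phi> z \<in> borel_measurable ?L" if [measurable]: "z \<in> borel_measurable ?H" for z
  proof -
    have [measurable]: "(\<lambda>p. \<tau> (fst p) (snd p)) \<in> borel_measurable ?L"
      "(\<lambda>p. incr (fst p) (snd p)) \<in> borel_measurable ?L"
      using \<tau> incr by (simp_all add: split_def)
    have [measurable]: "Q \<in> borel_measurable borel" unfolding Q_def by measurable
    show ?thesis unfolding \<Phi>_def[abs_def] by measurable
  qed
  have L: "(\<lambda>\<omega>. (\<omega>, ?W \<omega>)) \<in> measurable M ?L" "(\<lambda>\<omega>. (\<omega>, reflect_path (?W \<omega>))) \<in> measurable M ?L"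
    "distr M ?L (\<lambda>\<omega>. (\<omega>, ?W \<omega>)) = distr M ?L (\<lambda>\<omega>. (\<omega>, reflect_path (?W \<omega>)))"
    using distr_history_restart_symmetric[OF S] by blast+
  define cost where "cost z \<omega> = (if S \<omega> \<le> s \<and> s < T \<omega> then ennreal (Q (v s \<omega> - v (S \<omega>) \<omega> + z \<omega>)) else 0)" for z \<omega>
  define rcost where "rcost \<omega> = (if S \<omega> \<le> s \<and> s < T \<omega> then ennreal (Q (- (v s \<omega> - v (S \<omega>) \<omega>) + y \<omega>)) else 0)" for \<omega>
  have cost_eq: "\<Phi> z (\<omega>, ?W \<omega>) = cost z \<omega>" if "\<omega> \<in> space M" for \<omega> z
    using incr_W[OF that] T_eq[OF that] by (simp add: \<Phi>_def cost_def)
  \<comment> \<open>The symmetry of the trigger enters here: reflecting the path leaves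
    \<open>\<tau>\<close>, and hence the stage event, unchanged.\<close>
  have rcost_eq: "\<Phi> y (\<omega>, reflect_path (?W \<omega>)) = rcost \<omega>" if "\<omega> \<in> space M" for \<omega>
    using incr_rW[OF that] T_eq[OF that] \<tau>_sym[OF that measurable_space[OF W that]]
    by (simp add: \<Phi>_def rcost_def)
  have cost_meas: "cost z \<in> borel_measurable M" if "z \<in> borel_measurable ?H" for z
    using measurable_compose[OF L(1) \<Phi>[OF that]] cost_eq by (simp cong: measurable_cong)
  have rcost_meas: "rcost \<in> borel_measurable M"
    using measurable_compose[OF L(2) \<Phi>[OF y]] rcost_eq by (simp cong: measurable_cong)
  have z0: "(\<lambda>_. 0) \<in> borel_measurable ?H" by simp
  have "(\<integral>\<^sup>+\<omega>. cost y \<omega> \<partial>M) = (\<integral>\<^sup>+\<omega>. \<Phi> y (\<omega>, ?W \<omega>) \<partial>M)"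
    by (rule nn_integral_cong) (simp add: cost_eq)
  also have "\<dots> = (\<integral>\<^sup>+p. \<Phi> y p \<partial>distr M ?L (\<lambda>\<omega>. (\<omega>, ?W \<omega>)))"
    by (rule nn_integral_distr[symmetric]) (use L(1) \<Phi>[OF y] in simp_all)
  also have "\<dots> = (\<integral>\<^sup>+\<omega>. \<Phi> y (\<omega>, reflect_path (?W \<omega>)) \<partial>M)"
    unfolding L(3) by (rule nn_integral_distr) (use L(2) \<Phi>[OF y] in simp_all)
  also have "\<dots> = (\<integral>\<^sup>+\<omega>. rcost \<omega> \<partial>M)"
    by (rule nn_integral_cong) (simp add: rcost_eq)
  finally have sym_cost: "(\<integral>\<^sup>+\<omega>. cost y \<omega> \<partial>M) = (\<integral>\<^sup>+\<omega>. rcost \<omega> \<partial>M)" .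
  have Q_nonneg: "0 \<le> Q x" for x unfolding Q_def by (rule laplacian_form_nonneg[OF assms(1)])
  have "2 * (\<integral>\<^sup>+\<omega>. cost (\<lambda>_. 0) \<omega> \<partial>M) = (\<integral>\<^sup>+\<omega>. cost (\<lambda>_. 0) \<omega> + cost (\<lambda>_. 0) \<omega> \<partial>M)"
    using cost_meas[OF z0] by (simp add: nn_integral_add mult_2)
  also have "\<dots> \<le> (\<integral>\<^sup>+\<omega>. cost y \<omega> + rcost \<omega> \<partial>M)"
  proof (rule nn_integral_mono)
    fix \<omega>
    let ?w = "v s \<omega> - v (S \<omega>) \<omega>"
    \<comment> \<open>The parallelogram identity, with the nonnegative term
      \<open>2 * Q (y \<omega>)\<close> dropped.\<close>
    have "Q ?w + Q ?w \<le> Q (?w + y \<omega>) + Q (- ?w + y \<omega>)"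
      using laplacian_form_parallelogram[where x = ?w and y = "y \<omega>" and E = E] Q_nonneg[of "y \<omega>"] unfolding Q_def by linarith
    then have "ennreal (Q ?w) + ennreal (Q ?w) \<le> ennreal (Q (?w + y \<omega>)) + ennreal (Q (- ?w + y \<omega>))"
      by (simp add: Q_nonneg ennreal_plus[symmetric] del: ennreal_plus)
    then show "cost (\<lambda>_. 0) \<omega> + cost (\<lambda>_. 0) \<omega> \<le> cost y \<omega> + rcost \<omega>"
      by (simp add: cost_def rcost_def)
  qed
  also have "\<dots> = 2 * (\<integral>\<^sup>+\<omega>. cost y \<omega> \<partial>M)"
    using cost_meas[OF y] rcost_meas sym_cost by (simp add: nn_integral_add mult_2)
  finally have "(\<integral>\<^sup>+\<omega>. cost (\<lambda>_. 0) \<omega> \<partial>M) \<le> (\<integral>\<^sup>+\<omega>. cost y \<omega> \<partial>M)"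
    by (subst (asm) ennreal_mult_le_mult_iff) auto
  then show ?thesis unfolding cost_def add_0_right .
qed

end

section \<open>Causal inputs\<close>

text \<open>The end of stage \<open>k\<close> is not known during stage \<open>k\<close>, hence \<open>g k\<close> is used without upper bound.\<close>

fun stagewise :: "(nat \<Rightarrow> 'a \<Rightarrow> real) \<Rightarrow> (nat \<Rightarrow> real \<Rightarrow> 'a \<Rightarrow> real) \<Rightarrow> nat \<Rightarrow> real \<Rightarrow> 'a \<Rightarrow> real" where
  "stagewise t g 0 r \<omega> = g 0 r \<omega>"
| "stagewise t g (Suc k) r \<omega> = (if t k \<omega> \<le> r then g (Suc k) r \<omega> else stagewise t g k r \<omega>)"

lemma stagewise_eq:
  assumes "\<And>l r. r \<in> stage t l \<omega> \<Longrightarrow> f r = g l r \<omega>" "0 \<le> r" "r < t k \<omega>"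
  shows "stagewise t g k r \<omega> = f r"
  using assms(3)
proof (induction k)
  case 0
  then show ?case using assms(1)[of r 0] assms(2) by (simp add: stage_def)
next
  case (Suc k)
  then show ?case using assms(1)[of r "Suc k"] by (simp add: stage_def)
qed

lemma measurable_stagewise:
  assumes "\<And>l. l \<le> k \<Longrightarrow> (\<lambda>(r, \<omega>). g l r \<omega>) \<in> borel_measurable (borel \<Otimes>\<^sub>M N)"
    and "\<And>l. l < k \<Longrightarrow> t l \<in> borel_measurable N"
  shows "(\<lambda>(r, \<omega>). stagewise t g k r \<omega>) \<in> borel_measurable (borel \<Otimes>\<^sub>M N)"
  using assms
proof (induction k)
  case 0
  then show ?case by simp
next
  case (Suc k)
  have [measurable]: "(\<lambda>(r, \<omega>). stagewise t g k r \<omega>) \<in> borel_measurable (borel \<Otimes>\<^sub>M N)"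
    using Suc by simp
  have [measurable]: "(\<lambda>(r, \<omega>). g (Suc k) r \<omega>) \<in> borel_measurable (borel \<Otimes>\<^sub>M N)" "t k \<in> borel_measurable N"
    using Suc.prems by auto
  have "(\<lambda>(r, \<omega>). if t k \<omega> \<le> r then g (Suc k) r \<omega> else stagewise t g k r \<omega>) \<in> borel_measurable (borel \<Otimes>\<^sub>M N)"
    by measurable
  then show ?case by simp
qed

section \<open>The stages as a partition of time\<close>

lemma stage_start_mono:
  assumes "trigger_times M t" "\<omega> \<in> space M" "k \<le> l"
  shows "stage_start t k \<omega> \<le> stage_start t l \<omega>"
proof -
  have "0 \<le> t 0 \<omega>" "strict_mono (\<lambda>k. t k \<omega>)" using assms unfolding trigger_times_def by auto
  then have "stage_start t k \<omega> \<le> stage_start t (Suc k) \<omega>" for k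
    by (cases k) (auto simp: strict_mono_Suc_iff less_imp_le)
  then show ?thesis using assms(3) by (rule lift_Suc_mono_le)
qed

lemma stage_start_nonneg:
  "trigger_times M t \<Longrightarrow> \<omega> \<in> space M \<Longrightarrow> 0 \<le> stage_start t k \<omega>"
  using stage_start_mono[of M t \<omega> 0 k] by simp

lemma stage_unique:
  assumes "trigger_times M t" "\<omega> \<in> space M" "s \<in> stage t k \<omega>" "s \<in> stage t l \<omega>"
  shows "k = l"
proof (rule ccontr)
  assume "k \<noteq> l"
  then have "Suc k \<le> l \<or> Suc l \<le> k" by auto
  then show False
    using stage_start_mono[OF assms(1,2), of "Suc k" l] stage_start_mono[OF assms(1,2), of "Suc l" k] assms(3,4)
    by (auto simp: stage_def)
qed

lemma stage_exists:
  assumes "trigger_times M t" "\<omega> \<in> space M" "0 \<le> s"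
  obtains k where "s \<in> stage t k \<omega>"
proof -
  have "filterlim (\<lambda>k. t k \<omega>) at_top sequentially" using assms unfolding trigger_times_def by auto
  then have "\<exists>k. s < t k \<omega>"
    unfolding filterlim_at_top_dense by (meson eventually_happens' sequentially_bot)
  define k where "k = (LEAST k. s < t k \<omega>)"
  have "s < t k \<omega>" unfolding k_def using \<open>\<exists>k. s < t k \<omega>\<close> by (rule LeastI_ex)
  moreover have "stage_start t k \<omega> \<le> s"
  proof (cases k)
    case (Suc j)
    then have "\<not> s < t j \<omega>" unfolding k_def using not_less_Least[of j "\<lambda>k. s < t k \<omega>"] by auto
    then show ?thesis using Suc by simp
  qed (use assms in simp)
  ultimately show thesis by (intro that[of k]) (simp add: stage_def)
qed

lemma trigger_before_iff:
  assumes "trigger_times M t" "\<omega> \<in> space M" "s \<in> stage t k \<omega>"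
  shows "t m \<omega> \<le> s \<longleftrightarrow> m < k"
proof
  assume "t m \<omega> \<le> s"
  then have "t m \<omega> < t k \<omega>" using assms(3) by (simp add: stage_def)
  then show "m < k" using assms(1,2) strict_mono_less[of "\<lambda>k. t k \<omega>" m k] by (auto simp: trigger_times_def)
next
  assume "m < k"
  then have "stage_start t (Suc m) \<omega> \<le> stage_start t k \<omega>"
    by (intro stage_start_mono[OF assms(1,2)]) simp
  then show "t m \<omega> \<le> s" using assms(3) by (simp add: stage_def)
qed

lemma measurable_Pair_subalgebra:
  assumes "subalgebra N F" "(\<lambda>(r, \<omega>). g r \<omega>) \<in> measurable (borel \<Otimes>\<^sub>M F) L"
  shows "(\<lambda>(r, \<omega>). g r \<omega>) \<in> measurable (borel \<Otimes>\<^sub>M N) L"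
proof -
  have "(\<lambda>\<omega>. \<omega>) \<in> measurable N F"
    by (rule measurable_from_subalg[OF assms(1)]) simp
  then have "(\<lambda>p. (fst p, snd p)) \<in> measurable (borel \<Otimes>\<^sub>M N) (borel \<Otimes>\<^sub>M F)"
    by (intro measurable_Pair measurable_fst measurable_compose[OF measurable_snd])
  from measurable_compose[OF this assms(2)] show ?thesis by (simp add: split_def)
qed

section \<open>Information and state under symmetric triggering\<close>

locale triggered_noise = brownian_noise M v
  for M :: "'a measure" and v :: "real \<Rightarrow> 'a \<Rightarrow> real ^ 'n::finite" +
  fixes t :: "nat \<Rightarrow> 'a \<Rightarrow> real"
  assumes triggers: "trigger_times M t"
    and symmetric_trigger: "symmetric_stopping_time M v (stage_start t k) (t k)"
begin

lemma stopping_time_stage_start: "stopping_time (noise_filtration M v) (stage_start t k)"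
  using symmetric_trigger unfolding symmetric_stopping_time_def
  by (cases k) (auto intro: stopping_time_const)

lemma stage_start_measurable: "stage_start t k \<in> borel_measurable M"
  by (rule measurable_stopping_time[OF stopping_time_stage_start sets_noise_filtration_subset])
    (simp add: space_F)

lemma trigger_measurable: "t k \<in> borel_measurable M"
  using stage_start_measurable[of "Suc k"] by simp

lemma noise_at_stage_start: "(\<lambda>\<omega>. v (stage_start t k \<omega>) \<omega>) \<in> borel_measurable M"
  using stage_start_nonneg[OF triggers] by (intro noise_at_random_time stage_start_measurable)

text \<open>The stages partition time, so for each outcome one summand survives. Agreement of
  \<open>f\<close> with the functions \<open>F k\<close> is asked almost surely, because causality
  ties the state to measurable laws only almost surely.\<close>

lemma nn_integral_by_stages:
  assumes "0 \<le> s" and F: "\<And>k. F k \<in> borel_measurable M"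
    and f: "AE \<omega> in M. \<forall>k. s \<in> stage t k \<omega> \<longrightarrow> f \<omega> = F k \<omega>"
  shows "(\<integral>\<^sup>+\<omega>. f \<omega> \<partial>M) =
    (\<Sum>k. \<integral>\<^sup>+\<omega>. (if stage_start t k \<omega> \<le> s \<and> s < t k \<omega> then F k \<omega> else 0) \<partial>M)"
proof -
  let ?F = "\<lambda>k \<omega>. if stage_start t k \<omega> \<le> s \<and> s < t k \<omega> then F k \<omega> else 0"
  have [measurable]: "stage_start t k \<in> borel_measurable M" "t k \<in> borel_measurable M" "F k \<in> borel_measurable M" for k
    using stage_start_measurable trigger_measurable F by auto
  have "AE \<omega> in M. f \<omega> = (\<Sum>k. ?F k \<omega>)"
    using f AE_space
  proof eventually_elim
    case (elim \<omega>)
    then obtain k where k: "s \<in> stage t k \<omega>" using stage_exists[OF triggers _ assms(1)] by blast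
    have "?F l \<omega> = 0" if "l \<notin> {k}" for l
      using that stage_unique[OF triggers _ k, of l] elim by (auto simp: stage_def)
    then have "(\<Sum>k. ?F k \<omega>) = ?F k \<omega>"
      by (subst suminf_finite[of "{k}"]) auto
    then show ?case using k elim by (auto simp: stage_def)
  qed
  then have "(\<integral>\<^sup>+\<omega>. f \<omega> \<partial>M) = (\<integral>\<^sup>+\<omega>. (\<Sum>k. ?F k \<omega>) \<partial>M)"
    by (rule nn_integral_cong_AE)
  also have "\<dots> = (\<Sum>k. \<integral>\<^sup>+\<omega>. ?F k \<omega> \<partial>M)"
    by (rule nn_integral_suminf) measurable
  finally show ?thesis .
qed

context
  fixes I :: "'n \<Rightarrow> nat \<Rightarrow> 'a measure"
  assumes info: "information_structure M v t I"
begin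

lemma info_mono:
  assumes "k \<le> l"
  shows "subalgebra (I i l) (I i k)"
  using assms
proof (induction rule: dec_induct)
  case base
  show ?case by (simp add: subalgebra_def)
next
  case (step l)
  have "subalgebra (I i (Suc l)) (I i l)" using info unfolding information_structure_def by blast
  with step.IH show ?case unfolding subalgebra_def by auto
qed

lemma info_local: "subalgebra (I i k) (local_info M v t i k)"
  and info_history: "subalgebra (noise_history M v (stage_start t k)) (I i k)"
  using info unfolding information_structure_def by blast+

lemma info_stage_start:
  assumes "l \<le> k"
  shows "stage_start t l \<in> borel_measurable (I i k)"
proof (rule measurable_from_subalg[OF info_local])
  show "stage_start t l \<in> borel_measurable (local_info M v t i k)"
    unfolding local_info_def using assms
    by (intro measurableI) (auto simp: space_measure_of_conv intro!: in_measure_of)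
qed

text \<open>\<open>local_info\<close> contains the stopped path at fixed times. The fixed time
  \<open>real n\<close> eventually exceeds the start of the stage, from where on the stopped path
  has the wanted value.\<close>

lemma info_noise: "(\<lambda>\<omega>. v (stage_start t k \<omega>) \<omega> $ i) \<in> borel_measurable (I i k)"
proof (rule borel_measurable_LIMSEQ_real)
  show "(\<lambda>\<omega>. v (min (real n) (stage_start t k \<omega>)) \<omega> $ i) \<in> borel_measurable (I i k)" for n
  proof (rule measurable_from_subalg[OF info_local])
    have "\<exists>s A. B = (\<lambda>\<omega>. v (min s (stage_start t k \<omega>)) \<omega> $ i) -` A \<inter> space M \<and> 0 \<le> s \<and> A \<in> sets borel"
      if "B = (\<lambda>\<omega>. v (min (real n) (stage_start t k \<omega>)) \<omega> $ i) -` A \<inter> space M" "A \<in> sets borel" for A B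
      using that of_nat_0_le_iff by blast
    then show "(\<lambda>\<omega>. v (min (real n) (stage_start t k \<omega>)) \<omega> $ i) \<in> borel_measurable (local_info M v t i k)"
      unfolding local_info_def
      by (intro measurableI) (auto simp: space_measure_of_conv intro!: in_measure_of)
  qed
  fix \<omega>
  obtain m :: nat where m: "stage_start t k \<omega> \<le> real m" using real_arch_simple by blast
  have "eventually (\<lambda>n. v (min (real n) (stage_start t k \<omega>)) \<omega> $ i = v (stage_start t k \<omega>) \<omega> $ i) sequentially"
    using eventually_ge_at_top[of m] by eventually_elim (simp add: min_absorb2 order_trans[OF m])
  then show "(\<lambda>n. v (min (real n) (stage_start t k \<omega>)) \<omega> $ i) \<longlonglongrightarrow> v (stage_start t k \<omega>) \<omega> $ i"
    by (rule tendsto_eventually)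
qed

text \<open>Information is never forgotten, so the laws of earlier stages remain available and the
  input accumulated since time 0 can be rebuilt in stage \<open>k\<close>. The function
  \<open>Y k\<close> has to be measurable on the whole space, although the identity concerns only
  outcomes for which \<open>s\<close> lies in stage \<open>k\<close>.\<close>

lemma causal_input_stagewise:
  assumes u: "causal_input M t I u" and s: "0 \<le> s"
  shows "\<exists>Y. (\<forall>k. Y k \<in> borel_measurable (I i k)) \<and>
    (AE \<omega> in M. \<forall>k. s \<in> stage t k \<omega> \<longrightarrow>
      (LINT r:{0..s}|lborel. density u i r \<omega>) + (\<Sum>m | impulse_time u i m \<omega> \<le> s. impulse_weight u i m \<omega>) = Y k \<omega>)"
proof -
  define dens_law where "dens_law k g \<longleftrightarrow> (\<lambda>(s, \<omega>). g s \<omega>) \<in> borel_measurable (borel \<Otimes>\<^sub>M I i k) \<and>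
    (AE \<omega> in M. \<forall>s\<in>stage t k \<omega>. density u i s \<omega> = g s \<omega>)" for k g
  have "\<forall>k. \<exists>g. dens_law k g"
    using u unfolding causal_input_def dens_law_def by blast
  then obtain g where "\<And>k. dens_law k (g k)" by metis
  then have g: "\<And>k. (\<lambda>(s, \<omega>). g k s \<omega>) \<in> borel_measurable (borel \<Otimes>\<^sub>M I i k)"
    "\<And>k. AE \<omega> in M. \<forall>s\<in>stage t k \<omega>. density u i s \<omega> = g k s \<omega>"
    unfolding dens_law_def by blast+
  define impulse_law where "impulse_law k m \<theta> h \<longleftrightarrow> \<theta> \<in> borel_measurable (I i k) \<and> h \<in> borel_measurable (I i k) \<and>
    (AE \<omega> in M. \<forall>s\<in>stage t k \<omega>. (impulse_time u i m \<omega> = s \<longleftrightarrow> \<theta> \<omega> = s) \<and>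
      (impulse_time u i m \<omega> = s \<longrightarrow> impulse_weight u i m \<omega> = h \<omega>))" for k m \<theta> h
  have "\<forall>k m. \<exists>\<theta> h. impulse_law k m \<theta> h"
    using u unfolding causal_input_def impulse_law_def by blast
  then obtain \<theta> h where "\<And>k m. impulse_law k m (\<theta> k m) (h k m)" by metis
  then have \<theta>: "\<And>k m. \<theta> k m \<in> borel_measurable (I i k)"
    and h: "\<And>k m. h k m \<in> borel_measurable (I i k)"
    and \<theta>h: "\<And>k m. AE \<omega> in M. \<forall>s\<in>stage t k \<omega>. (impulse_time u i m \<omega> = s \<longleftrightarrow> \<theta> k m \<omega> = s) \<and>
          (impulse_time u i m \<omega> = s \<longrightarrow> impulse_weight u i m \<omega> = h k m \<omega>)"
    unfolding impulse_law_def by blast+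
  \<comment> \<open>A candidate time \<open>\<theta> l m\<close> says something about impulse
    \<open>m\<close> only if it falls into stage \<open>l\<close>; otherwise it is
    discarded.\<close>
  define past where "past k m \<omega> = (\<Sum>l<k. if stage_start t l \<omega> \<le> \<theta> l m \<omega> \<and> \<theta> l m \<omega> < t l \<omega> then h l m \<omega> else 0)" for k m \<omega>
  \<comment> \<open>In the current stage the upper bound is \<open>s\<close>, since the end
    \<open>t k \<omega>\<close> of the stage is not yet known.\<close>
  define imp where "imp k m \<omega> = past k m \<omega> +
    (if stage_start t k \<omega> \<le> \<theta> k m \<omega> \<and> \<theta> k m \<omega> \<le> s then h k m \<omega> else 0)" for k m \<omega>
  \<comment> \<open>If \<open>s\<close> lies in stage \<open>k\<close>, the series almost surely has
    finitely many nonzero terms; written as a series over all \<open>m\<close> it is measurable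
    everywhere.\<close>
  define Y where "Y k \<omega> = (LINT r:{0..s}|lborel. stagewise t g k r \<omega>) + (\<Sum>m. imp k m \<omega>)" for k \<omega>
  have "Y k \<in> borel_measurable (I i k)" for k
  proof -
    have later: "f \<in> borel_measurable (I i k)" if "l \<le> k" "f \<in> borel_measurable (I i l)" for f :: "'a \<Rightarrow> real" and l
      by (rule measurable_from_subalg[OF info_mono[OF that(1)] that(2)])
    have trigger: "t l \<in> borel_measurable (I i k)" if "l < k" for l
      using info_stage_start[of "Suc l" k] that by simp
    have "past k m \<in> borel_measurable (I i k)" for m
      unfolding past_def[abs_def]
    proof (rule borel_measurable_sum)
      fix l assume "l \<in> {..<k}"
      then have [measurable]: "t l \<in> borel_measurable (I i k)" "stage_start t l \<in> borel_measurable (I i k)"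
        "\<theta> l m \<in> borel_measurable (I i k)" "h l m \<in> borel_measurable (I i k)"
        using trigger info_stage_start later[OF _ \<theta>] later[OF _ h] by auto
      show "(\<lambda>\<omega>. if stage_start t l \<omega> \<le> \<theta> l m \<omega> \<and> \<theta> l m \<omega> < t l \<omega> then h l m \<omega> else 0) \<in> borel_measurable (I i k)"
        by measurable
    qed
    moreover have "stage_start t k \<in> borel_measurable (I i k)" by (rule info_stage_start) simp
    ultimately have "imp k m \<in> borel_measurable (I i k)" for m
      unfolding imp_def[abs_def] using \<theta>[of k m] h[of k m] by measurable
    then have [measurable]: "(\<lambda>\<omega>. \<Sum>m. imp k m \<omega>) \<in> borel_measurable (I i k)"
      by (rule borel_measurable_suminf)
    have [measurable]: "(\<lambda>(r, \<omega>). stagewise t g k r \<omega>) \<in> borel_measurable (borel \<Otimes>\<^sub>M I i k)"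
      by (rule measurable_stagewise) (use trigger in \<open>auto intro: measurable_Pair_subalgebra[OF info_mono g(1)]\<close>)
    have "(\<lambda>\<omega>. LINT r|lborel. indicator {0..s} r *\<^sub>R stagewise t g k r \<omega>) \<in> borel_measurable (I i k)"
    proof (rule lborel.borel_measurable_lebesgue_integral)
      have "(\<lambda>p. stagewise t g k (snd p) (fst p)) \<in> borel_measurable (I i k \<Otimes>\<^sub>M lborel)"
        using measurable_compose[of "\<lambda>p. (snd p, fst p)" "I i k \<Otimes>\<^sub>M lborel" "borel \<Otimes>\<^sub>M I i k"
            "\<lambda>(r, \<omega>). stagewise t g k r \<omega>" borel]
        by (simp add: split_def)
      then show "(\<lambda>(\<omega>, r). indicator {0..s} r *\<^sub>R stagewise t g k r \<omega>) \<in> borel_measurable (I i k \<Otimes>\<^sub>M lborel)"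
        unfolding split_def by measurable
    qed
    then show ?thesis unfolding Y_def[abs_def] set_lebesgue_integral_def by measurable
  qed
  moreover have "AE \<omega> in M. \<forall>k. s \<in> stage t k \<omega> \<longrightarrow>
      (LINT r:{0..s}|lborel. density u i r \<omega>) + (\<Sum>m | impulse_time u i m \<omega> \<le> s. impulse_weight u i m \<omega>) = Y k \<omega>"
  proof -
    have "AE \<omega> in M. \<forall>k. \<forall>s\<in>stage t k \<omega>. density u i s \<omega> = g k s \<omega>"
      using g(2) by (simp add: AE_all_countable)
    moreover have "AE \<omega> in M. \<forall>k m. \<forall>s\<in>stage t k \<omega>. (impulse_time u i m \<omega> = s \<longleftrightarrow> \<theta> k m \<omega> = s) \<and>
          (impulse_time u i m \<omega> = s \<longrightarrow> impulse_weight u i m \<omega> = h k m \<omega>)"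
      using \<theta>h by (simp add: AE_all_countable)
    moreover have "AE \<omega> in M. \<forall>s\<ge>0. set_integrable lborel {0..s} (\<lambda>r. density u i r \<omega>) \<and>
        (\<forall>m. 0 \<le> impulse_time u i m \<omega>) \<and> finite {m. impulse_time u i m \<omega> \<le> s}"
      using u unfolding causal_input_def well_posed_def by blast
    ultimately show ?thesis using AE_space
    proof eventually_elim
      case (elim \<omega>)
      have \<omega>: "\<omega> \<in> space M" using elim by blast
      have dens: "density u i r \<omega> = g k r \<omega>" if "r \<in> stage t k \<omega>" for k r using elim that by blast
      have impulse: "impulse_time u i m \<omega> = r \<longleftrightarrow> \<theta> k m \<omega> = r"
        "impulse_time u i m \<omega> = r \<Longrightarrow> impulse_weight u i m \<omega> = h k m \<omega>" if "r \<in> stage t k \<omega>" for k r m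
        using elim that by blast+
      have nonneg: "0 \<le> impulse_time u i m \<omega>" for m using elim by blast
      have fin: "finite {m. impulse_time u i m \<omega> \<le> s}" using elim s by blast
      \<comment> \<open>Within the stage the actual and the candidate impulse time hit the same
        instants, so they either coincide or both lie outside \<open>A\<close>.\<close>
      have hit: "(if \<theta> k m \<omega> \<in> A then h k m \<omega> else 0) =
          (if impulse_time u i m \<omega> \<in> A then impulse_weight u i m \<omega> else 0)" if A: "A \<subseteq> stage t k \<omega>" for A k m
      proof (cases "impulse_time u i m \<omega> = \<theta> k m \<omega>")
        case True
        then show ?thesis using impulse(2)[OF subsetD[OF A] True] by simp
      next
        case False
        then have "\<theta> k m \<omega> \<notin> A" using impulse(1)[OF subsetD[OF A], of "\<theta> k m \<omega>" m] by metis
        moreover have "impulse_time u i m \<omega> \<notin> A"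
          using False impulse(1)[OF subsetD[OF A], of "impulse_time u i m \<omega>" m] by metis
        ultimately show ?thesis by simp
      qed
      \<comment> \<open>The completed stages exhaust the time from 0 to the start of stage
        \<open>k\<close>, and no impulse time is negative.\<close>
      have past: "past k m \<omega> = (if impulse_time u i m \<omega> < stage_start t k \<omega> then impulse_weight u i m \<omega> else 0)" for k m
      proof (induction k)
        case 0
        then show ?case using nonneg[of m] by (simp add: past_def)
      next
        case (Suc k)
        have "stage_start t k \<omega> \<le> t k \<omega>" using stage_start_mono[OF triggers \<omega>, of k "Suc k"] by simp
        moreover have "past (Suc k) m \<omega> = past k m \<omega> +
            (if impulse_time u i m \<omega> \<in> stage t k \<omega> then impulse_weight u i m \<omega> else 0)"
          unfolding hit[OF subset_refl, symmetric] by (simp add: past_def stage_def)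
        ultimately show ?case unfolding Suc.IH by (auto simp: stage_def)
      qed
      show ?case
      proof (intro allI impI)
        fix k assume k: "s \<in> stage t k \<omega>"
        have imp: "imp k m \<omega> = (if impulse_time u i m \<omega> \<le> s then impulse_weight u i m \<omega> else 0)" for m
        proof -
          have "imp k m \<omega> = past k m \<omega> + (if stage_start t k \<omega> \<le> impulse_time u i m \<omega> \<and> impulse_time u i m \<omega> \<le> s
              then impulse_weight u i m \<omega> else 0)"
          proof -
            have "{stage_start t k \<omega>..s} \<subseteq> stage t k \<omega>" using k by (auto simp: stage_def)
            from hit[OF this, of m] show ?thesis by (simp add: imp_def)
          qed
          then show ?thesis unfolding past using k by (auto simp: stage_def)
        qed
        have "(\<Sum>m. imp k m \<omega>) = (\<Sum>m | impulse_time u i m \<omega> \<le> s. impulse_weight u i m \<omega>)"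
          unfolding imp using fin by (subst suminf_finite[OF fin]) auto
        moreover have "(LINT r:{0..s}|lborel. stagewise t g k r \<omega>) = (LINT r:{0..s}|lborel. density u i r \<omega>)"
        proof (rule set_lebesgue_integral_cong)
          show "\<forall>r. r \<in> {0..s} \<longrightarrow> stagewise t g k r \<omega> = density u i r \<omega>"
            using k by (auto simp: stage_def[of t k] intro!: stagewise_eq[where f = "\<lambda>r. density u i r \<omega>"] dens)
        qed simp
        ultimately show "(LINT r:{0..s}|lborel. density u i r \<omega>) +
            (\<Sum>m | impulse_time u i m \<omega> \<le> s. impulse_weight u i m \<omega>) = Y k \<omega>"
          by (simp add: Y_def)
      qed
    qed
  qed
  ultimately show ?thesis by blast
qed

text \<open>The agents hold different information, and the noise history at the start of the stage
  is a common upper bound for all of it.\<close>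

lemma causal_state_decomposition:
  assumes u: "causal_input M t I u" and s: "0 \<le> s"
  obtains y where "\<And>k. y k \<in> borel_measurable (noise_history M v (stage_start t k))"
    "AE \<omega> in M. \<forall>k. s \<in> stage t k \<omega> \<longrightarrow>
      state v u s \<omega> = v s \<omega> - v (stage_start t k \<omega>) \<omega> + y k \<omega>"
proof -
  define law where "law i Y \<longleftrightarrow> (\<forall>k. Y k \<in> borel_measurable (I i k)) \<and>
    (AE \<omega> in M. \<forall>k. s \<in> stage t k \<omega> \<longrightarrow>
      (LINT r:{0..s}|lborel. density u i r \<omega>) + (\<Sum>m | impulse_time u i m \<omega> \<le> s. impulse_weight u i m \<omega>) = Y k \<omega>)" for i Y
  have "\<forall>i. \<exists>Y. law i Y"
    using causal_input_stagewise[OF u s] unfolding law_def by blast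
  then obtain Y where "\<And>i. law i (Y i)" by metis
  then have Y: "\<And>i k. Y i k \<in> borel_measurable (I i k)"
    "\<And>i. AE \<omega> in M. \<forall>k. s \<in> stage t k \<omega> \<longrightarrow>
      (LINT r:{0..s}|lborel. density u i r \<omega>) + (\<Sum>m | impulse_time u i m \<omega> \<le> s. impulse_weight u i m \<omega>) = Y i k \<omega>"
    unfolding law_def by blast+
  \<comment> \<open>The noise at the start of the stage joins the input, so that what remains is the
    noise increment since then.\<close>
  define y where "y k \<omega> = (\<chi> i. Y i k \<omega> + v (stage_start t k \<omega>) \<omega> $ i)" for k \<omega>
  show thesis
  proof
    fix k
    have "(\<lambda>\<omega>. y k \<omega> $ i) \<in> borel_measurable (noise_history M v (stage_start t k))" for i
      by (rule measurable_from_subalg[OF info_history[of k i]])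
        (auto simp: y_def intro!: borel_measurable_add Y info_noise)
    then show "y k \<in> borel_measurable (noise_history M v (stage_start t k))"
      by (rule borel_measurable_vecI)
  next
    have "AE \<omega> in M. \<forall>i k. s \<in> stage t k \<omega> \<longrightarrow>
      (LINT r:{0..s}|lborel. density u i r \<omega>) + (\<Sum>m | impulse_time u i m \<omega> \<le> s. impulse_weight u i m \<omega>) = Y i k \<omega>"
      using Y(2) by (simp add: AE_all_countable)
    then show "AE \<omega> in M. \<forall>k. s \<in> stage t k \<omega> \<longrightarrow>
      state v u s \<omega> = v s \<omega> - v (stage_start t k \<omega>) \<omega> + y k \<omega>"
      by eventually_elim (simp add: vec_eq_iff state_def y_def)
  qed
qed

end

end

section \<open>The consensus reset\<close>

lemma consensus_points_agree:
  assumes "consensus_points M E I c" "(i, j) \<in> E\<^sup>*" "\<omega> \<in> space M"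
  shows "c i k \<omega> = c j k \<omega>"
  using assms(2)
proof (induction rule: rtrancl_induct)
  case (step j l)
  then show ?case using assms(1,3) unfolding consensus_points_def by auto
qed simp

text \<open>The weights applied at \<open>t 0, \<dots>, t (k - 1)\<close> add up to the last consensus point minus the
  noise at \<open>t (k - 1)\<close>, so the feedback law has the explicit solution
  \<open>reset_total c v t i (Suc k) - reset_total c v t i k\<close>.\<close>

definition reset_total ::
  "('n \<Rightarrow> nat \<Rightarrow> 'a \<Rightarrow> real) \<Rightarrow> (real \<Rightarrow> 'a \<Rightarrow> real ^ 'n) \<Rightarrow> (nat \<Rightarrow> 'a \<Rightarrow> real) \<Rightarrow> 'n \<Rightarrow> nat \<Rightarrow> 'a \<Rightarrow> real" where
  "reset_total c v t i k \<omega> = (case k of 0 \<Rightarrow> 0 | Suc l \<Rightarrow> c i l \<omega> - v (t l \<omega>) \<omega> $ i)"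

lemma state_before_trigger:
  assumes "trigger_times M t" "\<omega> \<in> space M"
    and "\<And>s. density u i s \<omega> = 0" "\<And>k. impulse_time u i k \<omega> = t k \<omega>"
  shows "state_before v u (t k \<omega>) \<omega> $ i = (\<Sum>m<k. impulse_weight u i m \<omega>) + v (t k \<omega>) \<omega> $ i"
proof -
  have "{m. t m \<omega> < t k \<omega>} = {..<k}"
    using assms(1,2) strict_mono_less[of "\<lambda>k. t k \<omega>"] by (auto simp: trigger_times_def)
  then show ?thesis by (simp add: state_before_def assms(3,4) set_lebesgue_integral_def)
qed

lemma consensus_reset_inputD:
  assumes "consensus_reset_input M v t c u" "\<omega> \<in> space M"
  shows "density u i s \<omega> = 0" "impulse_time u i k \<omega> = t k \<omega>"
    "impulse_weight u i k \<omega> = c i k \<omega> - state_before v u (t k \<omega>) \<omega> $ i"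
  using assms unfolding consensus_reset_input_def by blast+

text \<open>The last weight subtracts the state before its impulse, which contains the sum of all
  earlier weights. These cancel, and only the last consensus point and the last noise value
  remain.\<close>

lemma consensus_reset_sum_weights:
  assumes "trigger_times M t" "consensus_reset_input M v t c u" "\<omega> \<in> space M"
  shows "(\<Sum>m<k. impulse_weight u i m \<omega>) = reset_total c v t i k \<omega>"
proof (cases k)
  case (Suc l)
  note D = consensus_reset_inputD[OF assms(2,3)]
  show ?thesis
    using state_before_trigger[where k = l and v = v, OF assms(1,3) D(1,2)] D(3)[of i l]
    by (simp add: Suc reset_total_def)
qed (simp add: reset_total_def)

lemma consensus_reset_weight:
  assumes "trigger_times M t" "consensus_reset_input M v t c u" "\<omega> \<in> space M"
  shows "impulse_weight u i k \<omega> = reset_total c v t i (Suc k) \<omega> - reset_total c v t i k \<omega>"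
  using consensus_reset_sum_weights[OF assms, of i k] consensus_reset_sum_weights[OF assms, of i "Suc k"] by simp

text \<open>The explicit weights make no reference to the state; telescoping shows that they satisfy
  the feedback equation.\<close>

lemma consensus_reset_input_exists:
  assumes "trigger_times M t"
  shows "\<exists>u. consensus_reset_input M v t c u"
proof -
  define u where "u = \<lparr>density = (\<lambda>_ _ _. 0), impulse_time = (\<lambda>_. t),
    impulse_weight = (\<lambda>i k \<omega>. reset_total c v t i (Suc k) \<omega> - reset_total c v t i k \<omega>)\<rparr>"
  have "impulse_weight u i k \<omega> = c i k \<omega> - state_before v u (t k \<omega>) \<omega> $ i" if "\<omega> \<in> space M" for i k \<omega>
  proof -
    have "(\<Sum>m<k. impulse_weight u i m \<omega>) = reset_total c v t i k \<omega>"
      using sum_lessThan_telescope[of "\<lambda>k. reset_total c v t i k \<omega>" k]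
      by (simp add: u_def reset_total_def)
    then show ?thesis
      by (subst state_before_trigger[OF assms that]) (simp_all add: u_def reset_total_def)
  qed
  then have "consensus_reset_input M v t c u"
    unfolding consensus_reset_input_def by (simp add: u_def)
  then show ?thesis ..
qed

context triggered_noise
begin

lemma consensus_reset_state:
  assumes u: "consensus_reset_input M v t c u" and \<omega>: "\<omega> \<in> space M" and s: "s \<in> stage t k \<omega>"
  shows "state v u s \<omega> $ i = (v s \<omega> - v (stage_start t k \<omega>) \<omega>) $ i + (case k of 0 \<Rightarrow> 0 | Suc l \<Rightarrow> c i l \<omega>)"
proof -
  have "{m. t m \<omega> \<le> s} = {..<k}"
    using trigger_before_iff[OF triggers \<omega> s] by auto
  then have "state v u s \<omega> $ i = reset_total c v t i k \<omega> + v s \<omega> $ i"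
    using consensus_reset_sum_weights[OF triggers u \<omega>, of i k] consensus_reset_inputD(1,2)[OF u \<omega>]
    by (simp add: state_def set_lebesgue_integral_def)
  \<comment> \<open>In stage 0 no reset has acted yet, and the increment is taken from
    \<open>v 0 \<omega> = 0\<close>.\<close>
  then show ?thesis
    using noise_0[OF \<omega>] by (cases k) (simp_all add: reset_total_def)
qed

text \<open>Impulse \<open>m\<close> acts at \<open>t m\<close>, the first instant of stage
  \<open>Suc m\<close>, and can occur in no other stage. By then \<open>c i m\<close> is known,
  while the earlier consensus point and noise value in its weight are remembered.\<close>

lemma consensus_reset_causal:
  assumes info: "information_structure M v t I" and c: "\<And>i k. c i k \<in> borel_measurable (I i (Suc k))"
    and u: "consensus_reset_input M v t c u"
  shows "causal_input M t I u"
  unfolding causal_input_def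
proof (intro conjI allI)
  note D = consensus_reset_inputD[OF u]
  show "well_posed M u"
    unfolding well_posed_def
  proof (intro allI AE_I2 impI conjI)
    fix i \<omega> and s :: real and m assume \<omega>: "\<omega> \<in> space M" and s: "0 \<le> s"
    show "set_integrable lborel {0..s} (\<lambda>r. density u i r \<omega>)"
      by (simp add: D[OF \<omega>] set_integrable_def)
    show "0 \<le> impulse_time u i m \<omega>"
      using stage_start_nonneg[OF triggers \<omega>, of "Suc m"] by (simp add: D[OF \<omega>])
    obtain k where "s \<in> stage t k \<omega>" using stage_exists[OF triggers \<omega> s] .
    then have "{m. impulse_time u i m \<omega> \<le> s} = {..<k}"
      using trigger_before_iff[OF triggers \<omega>] by (auto simp: D[OF \<omega>])
    then show "finite {m. impulse_time u i m \<omega> \<le> s}" by simp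
  qed
  fix i k
  have "(\<lambda>(s :: real, \<omega>). 0 :: real) \<in> borel_measurable (borel \<Otimes>\<^sub>M I i k)" by simp
  then show "\<exists>g. (\<lambda>(s, \<omega>). g s \<omega>) \<in> borel_measurable (borel \<Otimes>\<^sub>M I i k) \<and>
      (AE \<omega> in M. \<forall>s\<in>stage t k \<omega>. density u i s \<omega> = g s \<omega>)"
    by (intro exI[of _ "\<lambda>_ _. 0"] conjI AE_I2) (simp_all add: D)
  fix m
  show "\<exists>\<theta>\<in>borel_measurable (I i k). \<exists>h\<in>borel_measurable (I i k).
        AE \<omega> in M. \<forall>s\<in>stage t k \<omega>. (impulse_time u i m \<omega> = s \<longleftrightarrow> \<theta> \<omega> = s) \<and>
          (impulse_time u i m \<omega> = s \<longrightarrow> impulse_weight u i m \<omega> = h \<omega>)"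
  proof (cases "k = Suc m")
    case True
    have total: "reset_total c v t i l \<in> borel_measurable (I i k)" if "l \<le> k" for l
    proof (cases l)
      case 0
      then show ?thesis by (simp add: reset_total_def[abs_def])
    next
      case (Suc j)
      have "(\<lambda>\<omega>. c i j \<omega> - v (stage_start t l \<omega>) \<omega> $ i) \<in> borel_measurable (I i l)"
        using c[of i j] info_noise[OF info, of l i] Suc by simp
      then have "(\<lambda>\<omega>. c i j \<omega> - v (stage_start t l \<omega>) \<omega> $ i) \<in> borel_measurable (I i k)"
        by (rule measurable_from_subalg[OF info_mono[OF info that]])
      then show ?thesis by (simp add: reset_total_def[abs_def] Suc)
    qed
    have "t m \<in> borel_measurable (I i k)"
      using info_stage_start[OF info, of k k i] True by simp
    moreover have "(\<lambda>\<omega>. reset_total c v t i (Suc m) \<omega> - reset_total c v t i m \<omega>) \<in> borel_measurable (I i k)"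
      using True by (intro borel_measurable_diff total) auto
    moreover have "AE \<omega> in M. \<forall>s\<in>stage t k \<omega>. (impulse_time u i m \<omega> = s \<longleftrightarrow> t m \<omega> = s) \<and>
          (impulse_time u i m \<omega> = s \<longrightarrow>
            impulse_weight u i m \<omega> = reset_total c v t i (Suc m) \<omega> - reset_total c v t i m \<omega>)"
      by (rule AE_I2) (simp add: D(2) consensus_reset_weight[OF triggers u])
    ultimately show ?thesis
      by (intro bexI[of _ "t m"] bexI[of _ "\<lambda>\<omega>. reset_total c v t i (Suc m) \<omega> - reset_total c v t i m \<omega>"])
  next
    case False
    \<comment> \<open>Impulse \<open>m\<close> does not occur in this stage, so its candidate time
      must avoid the stage; -1 does, because stages contain nonnegative times only.\<close>
    have "impulse_time u i m \<omega> \<noteq> s \<and> -1 \<noteq> s" if \<omega>: "\<omega> \<in> space M" and s: "s \<in> stage t k \<omega>" for s \<omega>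
    proof -
      have "t m \<omega> \<in> stage t (Suc m) \<omega>"
        using triggers \<omega> unfolding trigger_times_def strict_mono_Suc_iff by (auto simp: stage_def)
      then have "t m \<omega> \<noteq> s" using stage_unique[OF triggers \<omega> s, of "Suc m"] False by auto
      moreover have "0 \<le> s" using stage_start_nonneg[OF triggers \<omega>, of k] s by (auto simp: stage_def)
      ultimately show ?thesis by (simp add: D[OF \<omega>])
    qed
    then have "AE \<omega> in M. \<forall>s\<in>stage t k \<omega>. (impulse_time u i m \<omega> = s \<longleftrightarrow> -1 = s) \<and>
          (impulse_time u i m \<omega> = s \<longrightarrow> impulse_weight u i m \<omega> = 0)"
      by (intro AE_I2) blast
    then show ?thesis
      by (intro bexI[of _ "\<lambda>_. -1"] bexI[of _ "\<lambda>_. 0"]) auto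
  qed
qed

lemma consensus_reset_cost_minimal:
  assumes E: "sym E" and agree: "\<And>i j k \<omega>. \<omega> \<in> space M \<Longrightarrow> c i k \<omega> = c j k \<omega>"
    and u: "consensus_reset_input M v t c u"
    and info: "information_structure M v t I" and u': "causal_input M t I u'"
    and s: "0 \<le> s"
  shows "(\<integral>\<^sup>+\<omega>. ennreal (state v u s \<omega> \<bullet> (laplacian E *v state v u s \<omega>)) \<partial>M)
    \<le> (\<integral>\<^sup>+\<omega>. ennreal (state v u' s \<omega> \<bullet> (laplacian E *v state v u' s \<omega>)) \<partial>M)"
proof -
  define Q where "Q x = x \<bullet> (laplacian E *v x)" for x :: "real ^ 'n"
  have Q[measurable]: "Q \<in> borel_measurable borel" unfolding Q_def by measurable
  define w where "w k \<omega> = v s \<omega> - v (stage_start t k \<omega>) \<omega>" for k \<omega>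
  have w[measurable]: "w k \<in> borel_measurable M" for k
    unfolding w_def by (intro borel_measurable_diff noise_measurable[OF s] noise_at_stage_start)
  obtain y where y: "\<And>k. y k \<in> borel_measurable (noise_history M v (stage_start t k))"
    "AE \<omega> in M. \<forall>k. s \<in> stage t k \<omega> \<longrightarrow> state v u' s \<omega> = w k \<omega> + y k \<omega>"
    using causal_state_decomposition[OF info u' s] unfolding w_def by blast
  have [measurable]: "y k \<in> borel_measurable M" for k
    by (rule measurable_from_noise_history[OF stopping_time_stage_start y(1)])
  have "Q (state v u s \<omega>) = Q (w k \<omega>)" if \<omega>: "\<omega> \<in> space M" and k: "s \<in> stage t k \<omega>" for k \<omega>
  proof -
    \<comment> \<open>Here \<open>undefined\<close> is an arbitrary agent: all consensus points
      agree, so any one of them gives the common offset.\<close>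
    have "state v u s \<omega> $ i = w k \<omega> $ i + (case k of 0 \<Rightarrow> 0 | Suc l \<Rightarrow> c undefined l \<omega>)" for i
      using consensus_reset_state[OF u \<omega> k, of i] agree[OF \<omega>, of i _ undefined]
      by (simp add: w_def split: nat.split)
    then show ?thesis unfolding Q_def by (rule laplacian_form_shift[OF E])
  qed
  then have reset: "AE \<omega> in M. \<forall>k. s \<in> stage t k \<omega> \<longrightarrow> ennreal (Q (state v u s \<omega>)) = ennreal (Q (w k \<omega>))"
    by (intro AE_I2) simp
  have other: "AE \<omega> in M. \<forall>k. s \<in> stage t k \<omega> \<longrightarrow> ennreal (Q (state v u' s \<omega>)) = ennreal (Q (w k \<omega> + y k \<omega>))"
    using y(2) by eventually_elim simp
  have stage_le: "(\<integral>\<^sup>+\<omega>. (if stage_start t k \<omega> \<le> s \<and> s < t k \<omega> then ennreal (Q (w k \<omega>)) else 0) \<partial>M)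
      \<le> (\<integral>\<^sup>+\<omega>. (if stage_start t k \<omega> \<le> s \<and> s < t k \<omega> then ennreal (Q (w k \<omega> + y k \<omega>)) else 0) \<partial>M)" for k
    unfolding Q_def w_def
    by (rule stage_cost_minimal[OF E s stopping_time_stage_start _ symmetric_trigger y(1)])
      (rule stage_start_nonneg[OF triggers])
  have "(\<integral>\<^sup>+\<omega>. ennreal (Q (state v u s \<omega>)) \<partial>M) =
      (\<Sum>k. \<integral>\<^sup>+\<omega>. (if stage_start t k \<omega> \<le> s \<and> s < t k \<omega> then ennreal (Q (w k \<omega>)) else 0) \<partial>M)"
    by (rule nn_integral_by_stages[OF s _ reset]) measurable
  also have "\<dots> \<le> (\<Sum>k. \<integral>\<^sup>+\<omega>. (if stage_start t k \<omega> \<le> s \<and> s < t k \<omega> then ennreal (Q (w k \<omega> + y k \<omega>)) else 0) \<partial>M)"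
    by (intro suminf_le stage_le summableI)
  also have "\<dots> = (\<integral>\<^sup>+\<omega>. ennreal (Q (state v u' s \<omega>)) \<partial>M)"
    by (rule nn_integral_by_stages[OF s _ other, symmetric]) measurable
  finally show ?thesis unfolding Q_def .
qed

end

text \<open>The comparison is available at every single time, so averaging over time and the limit
  superior call for monotonicity alone.\<close>

lemma performance_mono:
  assumes "\<And>s. 0 \<le> s \<Longrightarrow>
    (\<integral>\<^sup>+\<omega>. ennreal (state v u s \<omega> \<bullet> (laplacian E *v state v u s \<omega>)) \<partial>M)
    \<le> (\<integral>\<^sup>+\<omega>. ennreal (state v u' s \<omega> \<bullet> (laplacian E *v state v u' s \<omega>)) \<partial>M)"
  shows "performance M v E u \<le> performance M v E u'"
  unfolding performance_def
  by (intro Limsup_mono always_eventually allI mult_left_mono nn_integral_mono)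
    (auto simp: indicator_def intro: assms)

theorem proposition1:
  fixes M :: "'a measure"
    and v :: "real \<Rightarrow> 'a \<Rightarrow> real ^ 'n::finite"
    and E :: "('n \<times> 'n) set"
    and t :: "nat \<Rightarrow> 'a \<Rightarrow> real"
    and I :: "'n \<Rightarrow> nat \<Rightarrow> 'a measure"
    and c :: "'n \<Rightarrow> nat \<Rightarrow> 'a \<Rightarrow> real"
  assumes "prob_space M"
    and "indep_brownian_motions M v"
    and "sym E" and "irrefl E" and "\<forall>i j. (i, j) \<in> E\<^sup>*"
    and "trigger_times M t"
    and "\<forall>k. symmetric_stopping_time M v (stage_start t k) (t k)"
    and "information_structure M v t I"
    and "consensus_points M E I c"
  shows "(\<exists>u. consensus_reset_input M v t c u) \<and>
         (\<forall>u. consensus_reset_input M v t c u \<longrightarrow> optimal_causal_input M v t E I u)"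
proof -
  interpret prob_space M by fact
  interpret triggered_noise M v t
    by unfold_locales (use assms in auto)
  have c: "c i k \<in> borel_measurable (I i (Suc k))" for i k
    using assms(9) unfolding consensus_points_def by blast
  \<comment> \<open>Connectedness turns agreement of neighbours into agreement of all
    agents.\<close>
  have agree: "c i k \<omega> = c j k \<omega>" if "\<omega> \<in> space M" for i j k \<omega>
    using consensus_points_agree[OF assms(9) _ that] assms(5) by blast
  show ?thesis
    unfolding optimal_causal_input_def
    using consensus_reset_input_exists[OF assms(6)] consensus_reset_causal[OF assms(8) c]
    by (auto intro!: performance_mono consensus_reset_cost_minimal[OF assms(3) agree])
qed

end
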